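(* Consider the DC microgrid with $N$ distributed closed-loop converter controllers and a constant power load described in the context, with state $x=(i,v)$, potential $P$, modified potential $P^*$, and matrices $L$, $C$, $A$, $\gamma$ as defined there. Assume that every equilibrium of the microgrid satisfies $V_L\ge V_{min}$. Suppose that: (a) $P^*$ is radially unbounded, i.e. $P^*(x)\to\infty$ as $\|x\|\to\infty$; (b) $\sigma_{max}\left(L^{1/2}A^{-1}\gamma C^{-1/2}\right)<1$, where $\sigma_{max}(\cdot)$ denotes the largest singular value; and, at the equilibria of the microgrid, writing $v_e$ for the equilibrium value of $V_L$, $$\frac{1}{R_L}-\frac{P_L}{v_e^2}+\sum_{i=1}^N\frac{1}{R_{ti}}-\sum_{i=1}^N\frac{1}{R_{ti}^2\left(\frac{1}{R_{pi}}+\frac{1}{R_{qi}}+\frac{1}{R_{ti}}\right)}\ \ge\ 0 .$$ Then the microgrid is globally asymptotically stable (large-signal stable): it has at least one stable equilibrium point, and every trajectory, from any initial condition, converges to a stable equilibrium point.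
   Context: Parameters: an integer $N\ge1$; positive reals $R_{pi},R_{qi},R_{ti},L_{qi},L_{ti},C_{bi}$ for $i=1,\dots,N$; positive reals $C_L,R_L,P_L,V_{min},I_{max}$ with $I_{max}=P_L/V_{min}$; reference voltages $V_{refi}$, which are real constants. State variables: $i=(I_{p1},\dots,I_{pN},I_{q1},\dots,I_{qN},I_{t1},\dots,I_{tN})\in\mathbb R^{3N}$, $v=(V_{C1},\dots,V_{CN},V_L)\in\mathbb R^{N+1}$, $x=(i,v)$. Constant power load: it draws the current $I_{PL}=I_{max}$ if $V_L<V_{min}$ and $I_{PL}=P_L/V_L$ if $V_L\ge V_{min}$. Potential: $$P(i,v)=\sum_{i=1}^N V_{refi}(I_{pi}+I_{qi})-\tfrac12\sum_{i=1}^N\left(R_{pi}I_{pi}^2+R_{qi}I_{qi}^2+R_{ti}I_{ti}^2\right)-\sum_{i=1}^N V_{Ci}(I_{pi}+I_{qi}-I_{ti})+\frac{V_L^2}{2R_L}-V_L\sum_{i=1}^N I_{ti}+\Phi(V_L),$$ where $\Phi(V_L)=I_{max}(V_L-V_{min})$ if $V_L<V_{min}$ and $\Phi(V_L)=\int_{V_{min}}^{V_L}\frac{P_L}{s}\,ds$ if $V_L\ge V_{min}$. Dynamics: $-J\frac{dx}{dt}=\frac{\partial P}{\partial x}$ with $J=\begin{bmatrix}-L&0\\0&C\end{bmatrix}$, $L=\mathrm{diag}(L_{p1},\dots,L_{pN},L_{q1},\dots,L_{qN},L_{t1},\dots,L_{tN})$, $C=\mathrm{diag}(C_{b1},\dots,C_{bN},C_L)$,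 where $L_{pi}=0$ for all $i$ (virtual inductors). Hence the equations for $I_{pi}$ are algebraic, and the system is explicitly $$I_{pi}=\frac{V_{refi}-V_{Ci}}{R_{pi}},\quad L_{qi}\frac{dI_{qi}}{dt}=V_{refi}-R_{qi}I_{qi}-V_{Ci},\quad L_{ti}\frac{dI_{ti}}{dt}=V_{Ci}-V_L-R_{ti}I_{ti},$$ $$C_{bi}\frac{dV_{Ci}}{dt}=I_{pi}+I_{qi}-I_{ti},\quad C_L\frac{dV_L}{dt}=\sum_{i=1}^N I_{ti}-I_{PL}-\frac{V_L}{R_L}.$$ Matrices: $A=\mathrm{diag}(R_{p1},\dots,R_{pN},R_{q1},\dots,R_{qN},R_{t1},\dots,R_{tN})$ and $$\gamma=\begin{bmatrix}-\mathbb I_{N\times N}&0_{N\times1}\\-\mathbb I_{N\times N}&0_{N\times1}\\ \mathbb I_{N\times N}&-1_{N\times1}\end{bmatrix}\in\mathbb R^{3N\times(N+1)},$$ where $\mathbb I$ is the identity matrix and $1_{N\times1}$ is the all-ones column. Modified potential: $P^*=P+\frac12\left(\frac{\partial P}{\partial x}\right)^T M\,\frac{\partial P}{\partial x}$ with $M=\begin{bmatrix}2A^{-1}&0\\0&0\end{bmatrix}$, i.e. $P^*=P+\left(\frac{\partial P}{\partial i}\right)^T A^{-1}\frac{\partial P}{\partial i}$. *)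

theory Defs
  imports "HOL-Analysis.Analysis"
begin

section \<open>Parameters and state space\<close>

text \<open>The finite index type \<open>'n\<close> enumerates the \<open>N = CARD('n) \<ge> 1\<close> converters. The virtual
  inductances \<open>L\<^sub>p\<^sub>i = 0\<close> are not parameters; they enter \<open>l_diag\<close> below as zeros.\<close>

record 'n microgrid =
  Rp :: "'n \<Rightarrow> real"
  Rq :: "'n \<Rightarrow> real"
  Rt :: "'n \<Rightarrow> real"
  Lq :: "'n \<Rightarrow> real"
  Lt :: "'n \<Rightarrow> real"
  Cb :: "'n \<Rightarrow> real"
  Vref :: "'n \<Rightarrow> real"
  CL :: real
  RL :: real
  PL :: real
  Vmin :: real
  Imax :: real

definition wf_microgrid :: "'n microgrid \<Rightarrow> bool" where
  "wf_microgrid G \<longleftrightarrow>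
     (\<forall>k. Rp G k > 0 \<and> Rq G k > 0 \<and> Rt G k > 0 \<and> Lq G k > 0 \<and> Lt G k > 0 \<and> Cb G k > 0) \<and>
     CL G > 0 \<and> RL G > 0 \<and> PL G > 0 \<and> Vmin G > 0 \<and> Imax G > 0 \<and>
     Imax G = PL G / Vmin G"

text \<open>Currents are indexed by three copies of \<open>'n\<close>, in the order \<open>p\<close>, \<open>q\<close>, \<open>t\<close>; voltages by
  \<open>'n\<close> (the capacitors) followed by one further index (the load).\<close>

type_synonym 'n cur = "'n + 'n + 'n"
type_synonym 'n vol = "'n + unit"
type_synonym 'n state = "(real, 'n cur) vec \<times> (real, 'n vol) vec"

definition Ip :: "'n::finite state \<Rightarrow> 'n \<Rightarrow> real" where "Ip x k = fst x $ Inl k"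
definition Iq :: "'n::finite state \<Rightarrow> 'n \<Rightarrow> real" where "Iq x k = fst x $ Inr (Inl k)"
definition It :: "'n::finite state \<Rightarrow> 'n \<Rightarrow> real" where "It x k = fst x $ Inr (Inr k)"
definition VC :: "'n::finite state \<Rightarrow> 'n \<Rightarrow> real" where "VC x k = snd x $ Inl k"
definition VL :: "'n::finite state \<Rightarrow> real" where "VL x = snd x $ Inr ()"


section \<open>Constant power load and dynamics\<close>

definition load_current :: "'n microgrid \<Rightarrow> real \<Rightarrow> real" where
  "load_current G u = (if u < Vmin G then Imax G else PL G / u)"

text \<open>\<open>dynamics G x dx\<close>: the differential-algebraic system at state \<open>x\<close> with velocity \<open>dx\<close>.\<close>

definition dynamics :: "'n::finite microgrid \<Rightarrow> 'n state \<Rightarrow> 'n state \<Rightarrow> bool" where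
  "dynamics G x dx \<longleftrightarrow>
     (\<forall>k. Ip x k = (Vref G k - VC x k) / Rp G k) \<and>
     (\<forall>k. Lq G k * Iq dx k = Vref G k - Rq G k * Iq x k - VC x k) \<and>
     (\<forall>k. Lt G k * It dx k = VC x k - VL x - Rt G k * It x k) \<and>
     (\<forall>k. Cb G k * VC dx k = Ip x k + Iq x k - It x k) \<and>
     CL G * VL dx = (\<Sum>k\<in>UNIV. It x k) - load_current G (VL x) - VL x / RL G"

definition equilibrium :: "'n::finite microgrid \<Rightarrow> 'n state \<Rightarrow> bool" where
  "equilibrium G e \<longleftrightarrow> dynamics G e 0"

definition forward_interval :: "real set \<Rightarrow> bool" where
  "forward_interval S \<longleftrightarrow> is_interval S \<and> 0 \<in> S \<and> S \<subseteq> {0..} \<and> S \<noteq> {0}"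

definition solution_on :: "'n::finite microgrid \<Rightarrow> real set \<Rightarrow> (real \<Rightarrow> 'n state) \<Rightarrow> bool" where
  "solution_on G S x \<longleftrightarrow>
     (\<forall>t\<in>S. \<exists>dx. (x has_vector_derivative dx) (at t within S) \<and> dynamics G (x t) dx)"

text \<open>Trajectories are maximal forward solutions, so finite escape is not excluded by definition.
  The algebraic equations hold at \<open>t = 0\<close> as well, so the initial states \<open>x 0\<close> are exactly the
  consistent ones.\<close>

definition trajectory :: "'n::finite microgrid \<Rightarrow> real set \<Rightarrow> (real \<Rightarrow> 'n state) \<Rightarrow> bool" where
  "trajectory G S x \<longleftrightarrow> forward_interval S \<and> solution_on G S x \<and>
     (\<forall>S' y. forward_interval S' \<and> solution_on G S' y \<and> S \<subseteq> S' \<and> (\<forall>t\<in>S. y t = x t) \<longrightarrow> S' = S)"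

text \<open>Stability of an equilibrium is stability in the sense of Lyapunov.\<close>

definition stable_equilibrium :: "'n::finite microgrid \<Rightarrow> 'n state \<Rightarrow> bool" where
  "stable_equilibrium G e \<longleftrightarrow> equilibrium G e \<and>
     (\<forall>\<epsilon>>0. \<exists>\<delta>>0. \<forall>S x. trajectory G S x \<and> dist (x 0) e < \<delta> \<longrightarrow> (\<forall>t\<in>S. dist (x t) e < \<epsilon>))"

definition globally_asymptotically_stable :: "'n::finite microgrid \<Rightarrow> bool" where
  "globally_asymptotically_stable G \<longleftrightarrow>
     (\<exists>e. stable_equilibrium G e) \<and>
     (\<forall>S x. trajectory G S x \<longrightarrow>
        S = {0..} \<and> (\<exists>e. stable_equilibrium G e \<and> (x \<longlongrightarrow> e) at_top))"


section \<open>Matrices\<close>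

definition diag_mat :: "('a::finite \<Rightarrow> real) \<Rightarrow> real^'a^'a" where
  "diag_mat d = (\<chi> i j. if i = j then d i else 0)"

definition l_diag :: "'n microgrid \<Rightarrow> 'n cur \<Rightarrow> real" where
  "l_diag G c = (case c of Inl k \<Rightarrow> 0 | Inr (Inl k) \<Rightarrow> Lq G k | Inr (Inr k) \<Rightarrow> Lt G k)"

definition c_diag :: "'n microgrid \<Rightarrow> 'n vol \<Rightarrow> real" where
  "c_diag G w = (case w of Inl k \<Rightarrow> Cb G k | Inr _ \<Rightarrow> CL G)"

definition a_diag :: "'n microgrid \<Rightarrow> 'n cur \<Rightarrow> real" where
  "a_diag G c = (case c of Inl k \<Rightarrow> Rp G k | Inr (Inl k) \<Rightarrow> Rq G k | Inr (Inr k) \<Rightarrow> Rt G k)"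

definition L_mat :: "'n::finite microgrid \<Rightarrow> ((real, 'n cur) vec, 'n cur) vec" where
  "L_mat G = diag_mat (l_diag G)"

definition C_mat :: "'n::finite microgrid \<Rightarrow> ((real, 'n vol) vec, 'n vol) vec" where
  "C_mat G = diag_mat (c_diag G)"

definition A_mat :: "'n::finite microgrid \<Rightarrow> ((real, 'n cur) vec, 'n cur) vec" where
  "A_mat G = diag_mat (a_diag G)"

definition L_sqrt :: "'n::finite microgrid \<Rightarrow> ((real, 'n cur) vec, 'n cur) vec" where
  "L_sqrt G = diag_mat (\<lambda>c. sqrt (l_diag G c))"

definition C_inv_sqrt :: "'n::finite microgrid \<Rightarrow> ((real, 'n vol) vec, 'n vol) vec" where
  "C_inv_sqrt G = diag_mat (\<lambda>w. 1 / sqrt (c_diag G w))"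

lemma diag_mat_mult: "diag_mat d ** diag_mat e = diag_mat (\<lambda>i. d i * e i)"
  by (simp add: diag_mat_def matrix_matrix_mult_def vec_eq_iff if_distrib [of "\<lambda>x. x * _"]
      cong: if_cong)

lemma diag_mat_one: "diag_mat (\<lambda>_. 1) = mat 1"
  by (simp add: diag_mat_def mat_def)

lemma L_sqrt_square: "wf_microgrid G \<Longrightarrow> L_sqrt G ** L_sqrt G = L_mat G"
  unfolding L_sqrt_def L_mat_def diag_mat_mult
  by (intro arg_cong [where f = diag_mat] ext)
    (auto simp: l_diag_def wf_microgrid_def less_imp_le split: sum.split)

lemma C_inv_sqrt_square: "wf_microgrid G \<Longrightarrow> C_inv_sqrt G ** C_inv_sqrt G ** C_mat G = mat 1"
  unfolding C_inv_sqrt_def C_mat_def diag_mat_mult diag_mat_one [symmetric]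
  by (intro arg_cong [where f = diag_mat] ext)
    (auto simp: c_diag_def wf_microgrid_def less_imp_le less_imp_neq [symmetric] split: sum.split)

text \<open>Block rows \<open>p\<close>, \<open>q\<close>, \<open>t\<close>; block columns \<open>VC\<close>, \<open>VL\<close>.\<close>

definition gamma_mat :: "((real, 'n::finite vol) vec, 'n cur) vec" where
  "gamma_mat = (\<chi> c w. case (c, w) of
       (Inl k, Inl j) \<Rightarrow> if k = j then -1 else 0
     | (Inl k, Inr _) \<Rightarrow> 0
     | (Inr (Inl k), Inl j) \<Rightarrow> if k = j then -1 else 0
     | (Inr (Inl k), Inr _) \<Rightarrow> 0
     | (Inr (Inr k), Inl j) \<Rightarrow> if k = j then 1 else 0
     | (Inr (Inr k), Inr _) \<Rightarrow> -1)"

text \<open>Singular values of \<open>B\<close> are the square roots of the eigenvalues of \<open>B\<^sup>T B\<close>.\<close>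

definition singular_values :: "real^'m^'n \<Rightarrow> real set" where
  "singular_values B =
     {s. s \<ge> 0 \<and> (\<exists>v. v \<noteq> 0 \<and> (transpose B ** B) *v v = (s\<^sup>2) *\<^sub>R v)}"

definition sigma_max :: "real^'m^'n \<Rightarrow> real" where
  "sigma_max B = Max (singular_values B)"


section \<open>Potentials\<close>

definition load_potential :: "'n microgrid \<Rightarrow> real \<Rightarrow> real" where
  "load_potential G u =
     (if u < Vmin G then Imax G * (u - Vmin G) else integral {Vmin G..u} (\<lambda>s. PL G / s))"

definition potential :: "'n::finite microgrid \<Rightarrow> 'n state \<Rightarrow> real" where
  "potential G x =
     (\<Sum>k\<in>UNIV. Vref G k * (Ip x k + Iq x k))
     - 1/2 * (\<Sum>k\<in>UNIV. Rp G k * (Ip x k)\<^sup>2 + Rq G k * (Iq x k)\<^sup>2 + Rt G k * (It x k)\<^sup>2)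
     - (\<Sum>k\<in>UNIV. VC x k * (Ip x k + Iq x k - It x k))
     + (VL x)\<^sup>2 / (2 * RL G)
     - VL x * (\<Sum>k\<in>UNIV. It x k)
     + load_potential G (VL x)"

definition current_gradient :: "('n::finite state \<Rightarrow> real) \<Rightarrow> 'n state \<Rightarrow> (real, 'n cur) vec" where
  "current_gradient F x = (\<chi> c. deriv (\<lambda>h. F (fst x + h *\<^sub>R axis c 1, snd x)) 0)"

definition modified_potential :: "'n::finite microgrid \<Rightarrow> 'n state \<Rightarrow> real" where
  "modified_potential G x =
     (let g = current_gradient (potential G) x
      in potential G x + g \<bullet> (matrix_inv (A_mat G) *v g))"

end

theory Submission
  imports Defs
begin

text \<open>On \<open>[Vmin, \<infinity>)\<close> the load voltages of equilibria are the zeros of a strictly convex function; the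
  slope condition makes every zero an up-crossing, so there is exactly one equilibrium \<open>e\<close>.
  Completing the squares in the currents and then in the capacitor voltages shows that \<open>P\<^sup>*\<close> is
  coercive with strict minimum \<open>e\<close>. Along trajectories its derivative is
  \<open>- z\<^sup>T L z - v\<^sup>T C v + 2 z\<^sup>T L A\<^sup>-\<^sup>1 \<gamma> v\<close> in the velocities \<open>z\<close> of the currents and \<open>v\<close> of the voltages, which
  the singular value condition makes negative definite, and LaSalle's argument applies. The load
  current is globally Lipschitz, so the maximal solutions are defined on all of \<open>[0, \<infinity>)\<close>.\<close>

section \<open>Lipschitz differential equations and Lyapunov functions\<close>

text \<open>The only nonconvex term of the energy is the load potential, a function of
  \<open>VL\<close> alone. With \<open>VL\<close> frozen, minimising over the other coordinates is
  quadratic and leaves \<open>reduced_potential\<close>, whose derivative is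
  \<open>current_mismatch\<close>. The search for equilibria and for the global minimum thus becomes
  one-dimensional, and the sign pattern of the mismatch settles it even where the slope condition
  holds with equality and linearisation is silent. The obstacle in the dynamics is the vanishing
  virtual inductance: \<open>L\<close> is singular, the velocity of \<open>Ip\<close> is invisible
  to the dissipation, and the system is not an ordinary differential equation. Differentiating the
  constraint produces a vector field on the whole state space that solves the problem of existence,
  but this field does not depend on \<open>Ip\<close> and so has zeros that violate the constraint.
  The decay rate is therefore positive only at consistent states other than \<open>e\<close>, and
  the convergence lemma is formulated relative to a closed set that contains the trajectory.\<close>

lemma integral_has_vector_derivative_atLeast:
  fixes g :: "real \<Rightarrow> 'a::banach"
  assumes "continuous_on {0..} g" and "0 \<le> t"
  shows "((\<lambda>t. integral {0..t} g) has_vector_derivative g t) (at t within {0..})"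
proof -
  have "((\<lambda>t. integral {0..t} g) has_vector_derivative g t) (at t within {0..t + 1})"
    using assms by (intro integral_has_vector_derivative continuous_on_subset [OF assms(1)]) auto
  moreover have "at t within {0..t + 1} = at t within {0..}"
    by (rule at_within_nhd [where S = "{..<t + 1}"]) auto
  ultimately show ?thesis by simp
qed

text \<open>Integrating a growth of \<open>exp (L * s)\<close> gains a factor \<open>1 / L\<close>,
  and the weight cancels the growth. This serves twice below: it keeps the weighted Picard iterates
  bounded, and it yields the contraction factor \<open>K / L\<close>.\<close>

lemma exp_weighted_integral_bound:
  fixes g :: "real \<Rightarrow> 'a::euclidean_space"
  assumes L: "L > 0" and t: "0 \<le> t" and c: "c \<ge> 0" and g: "continuous_on {0..} g"
    and bnd: "\<And>s. 0 \<le> s \<Longrightarrow> norm (g s) \<le> c * exp (L * s)"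
  shows "norm (exp (- (L * t)) *\<^sub>R integral {0..t} g) \<le> c / L"
proof -
  have "((\<lambda>s. c * exp (L * s)) has_integral (c / L * exp (L * t) - c / L * exp (L * 0))) {0..t}"
    using L t by (intro fundamental_theorem_of_calculus)
      (auto simp flip: has_real_derivative_iff_has_vector_derivative
        intro!: derivative_eq_intros)
  then have hi: "((\<lambda>s. c * exp (L * s)) has_integral (c / L * (exp (L * t) - 1))) {0..t}"
    by (simp add: algebra_simps)
  have "norm (integral {0..t} g) \<le> integral {0..t} (\<lambda>s. c * exp (L * s))"
  proof (rule integral_norm_bound_integral)
    show "g integrable_on {0..t}"
      by (intro integrable_continuous_interval continuous_on_subset [OF g]) auto
  qed (use hi bnd in auto)
  also have "\<dots> = c / L * (exp (L * t) - 1)"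
    using hi by (rule integral_unique)
  also have "\<dots> \<le> c / L * exp (L * t)"
    using L c by (intro mult_left_mono) auto
  finally have "exp (- (L * t)) * norm (integral {0..t} g) \<le> exp (- (L * t)) * (c / L * exp (L * t))"
    by (intro mult_left_mono) auto
  also have "\<dots> = c / L"
    by (simp add: exp_minus)
  finally show ?thesis by simp
qed

text \<open>With the weight \<open>exp (- L t)\<close>, \<open>L > K\<close>, the Picard operator contracts on all of \<open>[0, \<infinity>)\<close>
  at once; functions are extended to negative times by their value at \<open>0\<close>.\<close>

lemma lipschitz_ode_solution_exists:
  fixes F :: "'a::euclidean_space \<Rightarrow> 'a"
  assumes K: "K-lipschitz_on UNIV F"
  shows "\<exists>x. x 0 = x0 \<and> (\<forall>t\<ge>0. (x has_vector_derivative F (x t)) (at t within {0..}))"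
proof -
  define L where "L = K + 1"
  have K0: "K \<ge> 0" using K by (rule lipschitz_on_nonneg)
  have L: "L > 0" using K0 by (simp add: L_def)
  have Fc: "continuous_on UNIV F" using K by (rule lipschitz_on_continuous_on)
  \<comment> \<open>The unknown \<open>u\<close> is the weighted solution,
    \<open>x s = exp (L * s) u s\<close>. So \<open>g u\<close> is the right-hand side along
    \<open>x\<close>, and \<open>T u\<close> is the Picard iterate of \<open>x\<close>, weighted
    again.\<close>
  define g where "g u s = F (exp (L * s) *\<^sub>R apply_bcontfun u s)" for u :: "real \<Rightarrow>\<^sub>C 'a" and s
  define T where "T u t = exp (- (L * max 0 t)) *\<^sub>R (x0 + integral {0..max 0 t} (g u))" for u t
  have gc: "continuous_on {0..} (g u)" for u
    unfolding g_def
    by (intro continuous_intros continuous_on_compose2 [OF Fc]) auto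
  have Ic: "continuous_on {0..} (\<lambda>t. integral {0..t} (g u))" for u
    by (rule differentiable_imp_continuous_on)
      (auto simp: differentiable_on_def intro: differentiableI_vector
          integral_has_vector_derivative_atLeast [OF gc])
  have Tb: "T u \<in> bcontfun" for u
  proof (rule bcontfun_normI)
    show "continuous_on UNIV (T u)"
      unfolding T_def by (intro continuous_intros continuous_on_compose2 [OF Ic]) auto
    define c where "c = norm (F 0) + K * norm u"
    fix t :: real
    let ?t = "max 0 t"
    have "norm (g u s) \<le> c * exp (L * s)" if "0 \<le> s" for s
    proof -
      have "norm (g u s - F 0) \<le> K * norm (exp (L * s) *\<^sub>R apply_bcontfun u s - 0)"
        unfolding g_def using lipschitz_on_normD [OF K] by blast
      also have "\<dots> \<le> K * (exp (L * s) * norm u)"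
        using K0 norm_bounded [of u s] by (auto intro!: mult_left_mono)
      finally have "norm (g u s - F 0) \<le> K * norm u * exp (L * s)" by (simp add: mult_ac)
      moreover have "norm (F 0) \<le> norm (F 0) * exp (L * s)"
        using that L by (intro mult_right_le_one_le [THEN order_trans] mult_le_cancel_left1 [THEN iffD2]) auto
      moreover have "norm (g u s) \<le> norm (F 0) + norm (g u s - F 0)"
        by (rule norm_triangle_sub)
      ultimately show ?thesis by (simp add: c_def algebra_simps)
    qed
    moreover have "c \<ge> 0" using K0 by (simp add: c_def)
    ultimately have "norm (exp (- (L * ?t)) *\<^sub>R integral {0..?t} (g u)) \<le> c / L"
      by (intro exp_weighted_integral_bound L gc) auto
    moreover have "norm (exp (- (L * ?t)) *\<^sub>R x0) \<le> norm x0"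
      using L by (simp add: mult_left_le_one_le)
    ultimately show "norm (T u t) \<le> norm x0 + c / L"
      unfolding T_def scaleR_add_right by (meson add_mono norm_triangle_mono)
  qed
  have "\<exists>!u. Bcontfun (T u) = u"
  proof (rule banach_fix_type [of "K / L"])
    show "0 \<le> K / L" "K / L < 1" using K0 by (auto simp: L_def)
    show "\<forall>u w. dist (Bcontfun (T u)) (Bcontfun (T w)) \<le> K / L * dist u w"
    proof (intro allI dist_bound)
      fix u w :: "real \<Rightarrow>\<^sub>C 'a" and t :: real
      let ?t = "max 0 t"
      have int: "g u integrable_on {0..?t}" for u
        by (intro integrable_continuous_interval continuous_on_subset [OF gc]) auto
      have "norm (g u s - g w s) \<le> K * dist u w * exp (L * s)" if "0 \<le> s" for s
      proof -
        have "norm (g u s - g w s)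
            \<le> K * norm (exp (L * s) *\<^sub>R apply_bcontfun u s - exp (L * s) *\<^sub>R apply_bcontfun w s)"
          unfolding g_def using lipschitz_on_normD [OF K] by blast
        also have "\<dots> = K * (exp (L * s) * dist (apply_bcontfun u s) (apply_bcontfun w s))"
          by (simp flip: scaleR_diff_right add: dist_norm)
        also have "\<dots> \<le> K * (exp (L * s) * dist u w)"
          using K0 dist_bounded [of u s w] by (auto intro!: mult_left_mono)
        finally show ?thesis by (simp add: mult_ac)
      qed
      then have "norm (exp (- (L * ?t)) *\<^sub>R integral {0..?t} (\<lambda>s. g u s - g w s)) \<le> K * dist u w / L"
        using K0 by (intro exp_weighted_integral_bound L continuous_intros gc) auto
      also have "integral {0..?t} (\<lambda>s. g u s - g w s) = integral {0..?t} (g u) - integral {0..?t} (g w)"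
        by (intro integral_diff int)
      finally show "dist (apply_bcontfun (Bcontfun (T u)) t) (apply_bcontfun (Bcontfun (T w)) t)
          \<le> K / L * dist u w"
        by (simp add: Bcontfun_inverse Tb T_def dist_norm flip: scaleR_diff_right)
    qed
  qed
  then obtain u where "Bcontfun (T u) = u" by blast
  then have u: "apply_bcontfun u t = T u t" for t
    using Bcontfun_inverse [OF Tb] by metis
  define x where "x t = x0 + integral {0..t} (g u)" for t
  have gx: "g u t = F (x t)" if "0 \<le> t" for t
    using that by (simp add: g_def u [of t] T_def x_def flip: exp_add)
  have "(x has_vector_derivative F (x t)) (at t within {0..})" if "0 \<le> t" for t
  proof -
    have "x = (\<lambda>t. x0 + integral {0..t} (g u))"
      by (simp add: fun_eq_iff x_def)
    then have "(x has_vector_derivative 0 + g u t) (at t within {0..})"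
      using that by (simp only:) (intro has_vector_derivative_add has_vector_derivative_const
          integral_has_vector_derivative_atLeast [OF gc])
    then show ?thesis by (simp add: gx that)
  qed
  moreover have "x 0 = x0" by (simp add: x_def)
  ultimately show ?thesis by blast
qed

text \<open>Derivatives are taken within \<open>S\<close>, hence may be one-sided at its ends; the
  mean value theorem still applies on \<open>{a..b}\<close>. Below, \<open>c = 0\<close> gives
  monotonicity and a negative \<open>c\<close> gives linear decay.\<close>

lemma nonincreasing_on_interval:
  fixes f :: "real \<Rightarrow> real"
  assumes S: "is_interval S" and ab: "a \<in> S" "b \<in> S" "a \<le> b"
    and der: "\<And>t. t \<in> S \<Longrightarrow> (f has_real_derivative f' t) (at t within S)"
    and neg: "\<And>t. t \<in> S \<Longrightarrow> f' t \<le> c"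
  shows "f b - f a \<le> c * (b - a)"
proof (cases "a = b")
  case False
  have sub: "{a..b} \<subseteq> S"
    using S ab by (meson atLeastAtMost_iff mem_is_interval_1_I subsetI)
  have "\<exists>x\<in>{a<..<b}. f b - f a = (*) (f' x) (b - a)"
  proof (rule mvt_simple)
    fix t assume "a \<le> t" "t \<le> b"
    then have "(f has_derivative (*) (f' t)) (at t within S)"
      using der sub by (auto simp: has_field_derivative_def)
    then show "(f has_derivative (*) (f' t)) (at t within {a..b})"
      using sub by (rule has_derivative_subset)
  qed (use False ab in auto)
  then obtain z where "z \<in> {a<..<b}" "f b - f a = f' z * (b - a)"
    by blast
  moreover from this have "z \<in> S"
    using sub by auto
  ultimately show ?thesis
    using neg ab by (auto intro!: mult_right_mono)
qed auto

text \<open>Gronwall in differential form: the squared distance of the two solutions, multiplied by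
  \<open>exp (- (2 * K * s))\<close>, is nonincreasing, nonnegative and zero at the start.\<close>

lemma lipschitz_ode_solution_unique:
  fixes F :: "'a::euclidean_space \<Rightarrow> 'a"
  assumes K: "K-lipschitz_on UNIV F"
    and S: "is_interval S" "0 \<in> S" "S \<subseteq> {0..}"
    and x: "\<And>t. t \<in> S \<Longrightarrow> (x has_vector_derivative F (x t)) (at t within S)"
    and y: "\<And>t. t \<in> S \<Longrightarrow> (y has_vector_derivative F (y t)) (at t within S)"
    and init: "x 0 = y 0" and t: "t \<in> S"
  shows "x t = y t"
proof -
  define f where "f s = exp (- (2 * K * s)) * ((x s - y s) \<bullet> (x s - y s))" for s
  define f' where "f' s = exp (- (2 * K * s)) *
    (2 * ((F (x s) - F (y s)) \<bullet> (x s - y s)) - 2 * K * ((x s - y s) \<bullet> (x s - y s)))" for s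
  have "(f has_real_derivative f' s) (at s within S)" if "s \<in> S" for s
  proof -
    have d: "((\<lambda>s. x s - y s) has_vector_derivative F (x s) - F (y s)) (at s within S)"
      by (intro derivative_intros x y that)
    have "((\<lambda>s. (x s - y s) \<bullet> (x s - y s)) has_vector_derivative
        2 * ((F (x s) - F (y s)) \<bullet> (x s - y s))) (at s within S)"
      using bounded_bilinear.has_vector_derivative [OF bounded_bilinear_inner d d]
      by (simp add: inner_commute)
    then have "((\<lambda>s. (x s - y s) \<bullet> (x s - y s)) has_real_derivative
        2 * ((F (x s) - F (y s)) \<bullet> (x s - y s))) (at s within S)"
      by (simp add: has_real_derivative_iff_has_vector_derivative)
    moreover have "((\<lambda>s. exp (- (2 * K * s))) has_real_derivative
        - (2 * K) * exp (- (2 * K * s))) (at s within S)"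
      by (auto intro!: derivative_eq_intros)
    ultimately show ?thesis
      unfolding f_def [abs_def] f'_def
      by (intro DERIV_cong [OF DERIV_mult]) (auto simp: algebra_simps)
  qed
  moreover have "f' s \<le> 0" for s
  proof -
    have "(F (x s) - F (y s)) \<bullet> (x s - y s) \<le> norm (F (x s) - F (y s)) * norm (x s - y s)"
      by (rule norm_cauchy_schwarz)
    also have "\<dots> \<le> K * norm (x s - y s) * norm (x s - y s)"
      by (intro mult_right_mono lipschitz_on_normD [OF K]) auto
    also have "\<dots> = K * ((x s - y s) \<bullet> (x s - y s))"
      by (simp add: dot_square_norm power2_eq_square)
    finally show ?thesis
      by (simp add: f'_def mult_nonneg_nonpos)
  qed
  ultimately have "f t - f 0 \<le> 0 * (t - 0)"
    using S t by (intro nonincreasing_on_interval) auto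
  then have "(x t - y t) \<bullet> (x t - y t) \<le> 0"
    by (simp add: f_def init mult_le_0_iff)
  then show ?thesis
    by (metis eq_iff_diff_eq_0 inner_ge_zero inner_eq_zero_iff order_antisym)
qed

text \<open>Compactness of the sublevel sets turns smallness of \<open>W - W e\<close> into closeness to \<open>e\<close>.\<close>

lemma sublevel_subset_ball:
  fixes W :: "'a::euclidean_space \<Rightarrow> real"
  assumes W: "continuous_on UNIV W" and bdd: "\<And>c. bounded {x. W x \<le> c}"
    and min: "\<And>x. x \<noteq> e \<Longrightarrow> W e < W x" and eps: "\<epsilon> > 0"
  shows "\<exists>\<alpha>>0. \<forall>x. W x < W e + \<alpha> \<longrightarrow> dist x e < \<epsilon>"
proof -
  define S where "S = {x. W x \<le> W e + 1} \<inter> {x. \<epsilon> \<le> dist x e}"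
  have "closed S"
    unfolding S_def by (intro closed_Int closed_Collect_le continuous_intros W)
  then have S: "compact S"
    unfolding S_def compact_eq_bounded_closed using bdd bounded_Int by blast
  show ?thesis
  proof (cases "S = {}")
    case True
    then have "dist x e < \<epsilon>" if "W x < W e + 1" for x
    proof -
      have "x \<notin> S" using True by simp
      then show ?thesis using that by (simp add: S_def)
    qed
    then show ?thesis by (intro exI [of _ 1]) simp
  next
    case False
    then obtain z where z: "z \<in> S" "\<And>x. x \<in> S \<Longrightarrow> W z \<le> W x"
      using continuous_attains_inf [OF S _ continuous_on_subset [OF W]] by auto
    have "z \<noteq> e" using z eps by (auto simp: S_def)
    \<comment> \<open>The cap \<open>1\<close> keeps \<open>x\<close> in the sublevel set that
      defines \<open>S\<close>, so \<open>x\<close> can miss \<open>S\<close> only by being close to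
      \<open>e\<close>.\<close>
    moreover have "dist x e < \<epsilon>" if "W x < W e + min 1 (W z - W e)" for x
      using that z(2) [of x] by (force simp: S_def)
    ultimately show ?thesis
      using min [of z] by (intro exI [of _ "min 1 (W z - W e)"]) simp
  qed
qed

text \<open>LaSalle's argument without limit sets: while \<open>W\<close> stays at least \<alpha>
  above its minimum, the trajectory remains in a compact part of \<open>M\<close> where
  \<open>D\<close> has a positive minimum, and \<open>W\<close> would fall linearly without bound.
  The set \<open>M\<close> will be that of the consistent states.\<close>

lemma lyapunov_convergence:
  fixes W D :: "'a::euclidean_space \<Rightarrow> real"
  assumes W: "continuous_on UNIV W" and bdd: "\<And>c. bounded {x. W x \<le> c}"
    and min: "\<And>x. x \<noteq> e \<Longrightarrow> W e < W x"
    and D: "continuous_on UNIV D" "\<And>x. D x \<ge> 0" and M: "closed M"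
    and pos: "\<And>x. x \<in> M \<Longrightarrow> x \<noteq> e \<Longrightarrow> D x > 0"
    and xM: "\<And>t. 0 \<le> t \<Longrightarrow> x t \<in> M"
    and der: "\<And>t. 0 \<le> t \<Longrightarrow> ((\<lambda>t. W (x t)) has_real_derivative w t) (at t within {0..})"
    and decay: "\<And>t. 0 \<le> t \<Longrightarrow> w t \<le> - D (x t)"
  shows "(x \<longlongrightarrow> e) at_top"
proof -
  have mono: "W (x t) \<le> W (x s)" if "0 \<le> s" "s \<le> t" for s t
    using nonincreasing_on_interval [of "{0..}" s t "\<lambda>t. W (x t)" w 0] that der
      order_trans [OF decay] D(2) by (force simp: is_interval_ci)
  have reach: "\<exists>t\<ge>0. W (x t) < W e + \<alpha>" if "\<alpha> > 0" for \<alpha>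
  proof (rule ccontr)
    assume "\<not> (\<exists>t\<ge>0. W (x t) < W e + \<alpha>)"
    then have ge: "W e + \<alpha> \<le> W (x t)" if "0 \<le> t" for t
      using that by force
    define S where "S = {y. W e + \<alpha> \<le> W y} \<inter> {y. W y \<le> W (x 0)} \<inter> M"
    have xS: "x t \<in> S" if "0 \<le> t" for t
      using ge mono [of 0 t] xM that by (auto simp: S_def)
    have "closed S"
      unfolding S_def by (intro closed_Int closed_Collect_le continuous_intros W M)
    moreover have "bounded S"
      by (rule bounded_subset [OF bdd [of "W (x 0)"]]) (auto simp: S_def)
    ultimately have "compact S"
      by (simp add: compact_eq_bounded_closed)
    then obtain z where z: "z \<in> S" "\<And>y. y \<in> S \<Longrightarrow> D z \<le> D y"
      using continuous_attains_inf [of S D] xS [of 0] continuous_on_subset [OF D(1)] by blast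
    have Dz: "D z > 0"
      using z(1) \<open>\<alpha> > 0\<close> by (intro pos) (auto simp: S_def)
    have lin: "W (x t) - W (x 0) \<le> - D z * (t - 0)" if "0 \<le> t" for t
      using that z(2) [OF xS] order_trans [OF decay]
      by (intro nonincreasing_on_interval [where S = "{0..}" and f' = w] der)
        (force simp: is_interval_ci)+
    \<comment> \<open>At this time the linear bound has brought \<open>W\<close> down to
      \<open>W e\<close>, below the supposed floor \<open>W e + \<alpha>\<close>.\<close>
    define t where "t = (W (x 0) - W e) / D z"
    have "W e \<le> W (x 0)" using ge [of 0] that by simp
    then have "0 \<le> t" using Dz by (simp add: t_def)
    with lin [OF this] ge [OF this] that Dz show False
      by (simp add: t_def field_simps)
  qed
  show ?thesis
  proof (rule tendstoI)
    fix \<epsilon> :: real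
    assume "\<epsilon> > 0"
    then obtain \<alpha> where \<alpha>: "\<alpha> > 0" "\<And>y. W y < W e + \<alpha> \<Longrightarrow> dist y e < \<epsilon>"
      using sublevel_subset_ball [OF W bdd min] by blast
    obtain t0 where "t0 \<ge> 0" "W (x t0) < W e + \<alpha>"
      using reach [OF \<alpha>(1)] by blast
    then have "\<forall>t\<ge>t0. dist (x t) e < \<epsilon>"
      using \<alpha>(2) mono by (meson order_le_less_trans)
    then show "\<forall>\<^sub>F t in at_top. dist (x t) e < \<epsilon>"
      by (auto simp: eventually_at_top_linorder)
  qed
qed

section \<open>The largest singular value\<close>

lemma singular_values_inner:
  fixes B :: "real^'m^'n"
  shows "((transpose B ** B) *v v) \<bullet> w = (B *v v) \<bullet> (B *v w)"
  by (metis dot_lmul_matrix inner_commute matrix_vector_mul_assoc vector_transpose_matrix)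

text \<open>Needed because \<open>Max\<close> in \<open>sigma_max\<close> is informative only on a
  finite set. Distinct singular values are nonnegative, so their squares differ and the
  corresponding eigenvectors of the symmetric matrix are orthogonal, hence independent.\<close>

lemma finite_singular_values:
  fixes B :: "real^'m^'n"
  shows "finite (singular_values B)"
proof -
  let ?T = "transpose B ** B"
  have "\<forall>s\<in>singular_values B. \<exists>v. v \<noteq> 0 \<and> ?T *v v = s\<^sup>2 *\<^sub>R v"
    by (auto simp: singular_values_def)
  then obtain v where v: "\<And>s. s \<in> singular_values B \<Longrightarrow> v s \<noteq> 0 \<and> ?T *v v s = s\<^sup>2 *\<^sub>R v s"
    by metis
  have orth: "v s \<bullet> v t = 0" if s: "s \<in> singular_values B" and t: "t \<in> singular_values B"
    and "s \<noteq> t" for s t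
  proof -
    have "s\<^sup>2 * (v s \<bullet> v t) = (?T *v v s) \<bullet> v t"
      using v [OF s] by simp
    also have "\<dots> = (?T *v v t) \<bullet> v s"
      unfolding singular_values_inner by (rule inner_commute)
    also have "\<dots> = t\<^sup>2 * (v s \<bullet> v t)"
      using v [OF t] by (simp add: inner_commute)
    finally have "s\<^sup>2 = t\<^sup>2 \<or> v s \<bullet> v t = 0" by auto
    moreover have "s \<ge> 0" "t \<ge> 0"
      using s t by (auto simp: singular_values_def)
    ultimately show ?thesis
      using \<open>s \<noteq> t\<close> by simp
  qed
  have "pairwise orthogonal (v ` singular_values B)"
    using orth by (auto simp: pairwise_def orthogonal_def)
  then have "independent (v ` singular_values B)"
    by (rule pairwise_orthogonal_independent) (use v in auto)
  then have "finite (v ` singular_values B)"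
    by (rule independent_imp_finite)
  moreover have "inj_on v (singular_values B)"
    using orth v by (metis inj_onI inner_eq_zero_iff)
  ultimately show ?thesis
    by (rule finite_imageD)
qed

text \<open>The maximum of \<open>norm (B *v v)\<close> on the unit sphere is attained, and the
  first-order condition at a maximiser is exactly the eigenvector equation.\<close>

lemma norm_le_singular_value:
  fixes B :: "real^'m^'n"
  shows "\<exists>s\<in>singular_values B. \<forall>v. norm (B *v v) \<le> s * norm v"
proof -
  have "compact (sphere (0::real^'m) 1)" "sphere (0::real^'m) 1 \<noteq> {}"
    by auto
  then obtain v0 where v0: "norm v0 = 1" "\<And>v. norm v = 1 \<Longrightarrow> norm (B *v v) \<le> norm (B *v v0)"
    using continuous_attains_sup [of "sphere (0::real^'m) 1" "\<lambda>v. norm (B *v v)"]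
      continuous_on_norm [OF matrix_vector_mult_linear_continuous_on [of _ B]]
    by (auto simp: dist_norm)
  define s where "s = norm (B *v v0)"
  have bound: "norm (B *v v) \<le> s * norm v" for v
  proof (cases "v = 0")
    case False
    have "norm (B *v (v /\<^sub>R norm v)) \<le> s"
      unfolding s_def using False by (intro v0(2)) simp
    with False show ?thesis
      by (simp add: matrix_vector_mult_scaleR field_simps)
  qed simp
  have crit: "(B *v v0) \<bullet> (B *v w) = s\<^sup>2 * (v0 \<bullet> w)" for w
  proof -
    define l where "l = (B *v v0) \<bullet> (B *v w) - s\<^sup>2 * (v0 \<bullet> w)"
    define q where "q = s\<^sup>2 * (norm w)\<^sup>2 - (norm (B *v w))\<^sup>2"
    have "(norm (B *v v))\<^sup>2 \<le> (s * norm v)\<^sup>2" for v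
      using bound by (intro power_mono) auto
    then have le: "(B *v v) \<bullet> (B *v v) \<le> s\<^sup>2 * (v \<bullet> v)" for v
      by (simp add: power_mult_distrib dot_square_norm)
    have B0: "(B *v v0) \<bullet> (B *v v0) = s\<^sup>2" "v0 \<bullet> v0 = 1"
      using v0 by (auto simp: s_def dot_square_norm)
    \<comment> \<open>Perturbing the maximiser by \<open>t\<close> times \<open>w\<close>: a term
      linear in \<open>t\<close> is dominated by a quadratic one for every \<open>t\<close>, which
      forces \<open>l = 0\<close>.\<close>
    have quad: "2 * t * l \<le> t\<^sup>2 * q" for t
      using le [of "v0 + t *\<^sub>R w"] B0
      by (simp add: l_def q_def matrix_vector_right_distrib matrix_vector_mult_scaleR inner_add
          inner_commute power2_norm_eq_inner algebra_simps power2_eq_square [of t])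
    have q0: "q \<ge> 0"
      using le [of w] by (simp add: q_def power2_norm_eq_inner)
    \<comment> \<open>A value of \<open>t\<close> that exposes \<open>l\<close>: substituting
      \<open>l = m * (q + 1)\<close> leaves \<open>m\<^sup>2 * (q + 2) \<le> 0\<close>. The
      \<open>+ 1\<close> protects the division when \<open>q = 0\<close>.\<close>
    define m where "m = l / (q + 1)"
    have "l = m * (q + 1)" using q0 by (simp add: m_def)
    with quad [of m] have "m\<^sup>2 * (q + 2) \<le> 0"
      by (simp add: algebra_simps power2_eq_square)
    then have "m = 0" using q0 by (simp add: mult_le_0_iff)
    then have "l = 0" using \<open>l = m * (q + 1)\<close> by simp
    then show ?thesis by (simp add: l_def)
  qed
  have "((transpose B ** B) *v v0) \<bullet> w = (s\<^sup>2 *\<^sub>R v0) \<bullet> w" for w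
    by (simp add: singular_values_inner crit)
  then have "(transpose B ** B) *v v0 = s\<^sup>2 *\<^sub>R v0"
    by (subst vector_eq_rdot [symmetric]) blast
  moreover have "v0 \<noteq> 0" "s \<ge> 0"
    using v0(1) by (auto simp: s_def)
  ultimately have "s \<in> singular_values B"
    unfolding singular_values_def by blast
  with bound show ?thesis by blast
qed

lemma sigma_max_bound:
  fixes B :: "real^'m^'n"
  assumes "sigma_max B < c"
  shows "\<exists>s. 0 \<le> s \<and> s < c \<and> (\<forall>v. norm (B *v v) \<le> s * norm v)"
proof -
  obtain s where s: "s \<in> singular_values B" "\<forall>v. norm (B *v v) \<le> s * norm v"
    using norm_le_singular_value by blast
  moreover have "s \<le> sigma_max B"
    unfolding sigma_max_def using finite_singular_values s(1) by (rule Max_ge)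
  moreover have "0 \<le> s" using s(1) by (simp add: singular_values_def)
  ultimately show ?thesis using assms by auto
qed

section \<open>Diagonal matrices and state components\<close>

lemma sum_UNIV_sum_type:
  fixes f :: "'a::finite + 'b::finite \<Rightarrow> 'c::comm_monoid_add"
  shows "(\<Sum>c\<in>UNIV. f c) = (\<Sum>a\<in>UNIV. f (Inl a)) + (\<Sum>b\<in>UNIV. f (Inr b))"
  by (simp add: sum.Plus flip: UNIV_Plus_UNIV)

lemma diag_mat_vector: "(diag_mat d *v x) $ i = d i * x $ i"
  by (simp add: diag_mat_def matrix_vector_mult_def if_distrib [of "\<lambda>a. a * _"] cong: if_cong)

text \<open>\<open>matrix_inv\<close> is a choice among two-sided inverses, so exhibiting one
  inverse must be combined with uniqueness.\<close>

lemma matrix_inv_diag_mat: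
  assumes "\<And>i. d i \<noteq> 0"
  shows "matrix_inv (diag_mat d) = diag_mat (\<lambda>i. 1 / d i)"
proof -
  let ?B = "diag_mat (\<lambda>i. 1 / d i)"
  have inv: "diag_mat d ** ?B = mat 1" "?B ** diag_mat d = mat 1"
    using assms by (simp_all add: diag_mat_mult diag_mat_one)
  then show ?thesis
    unfolding matrix_inv_def
    by (rule someI2 [where a = ?B, OF conjI])
      (metis inv(1) matrix_mul_assoc matrix_mul_lid matrix_mul_rid)
qed

lemma wf_microgridD:
  assumes "wf_microgrid G"
  shows "Rp G k > 0" "Rq G k > 0" "Rt G k > 0" "Lq G k > 0" "Lt G k > 0" "Cb G k > 0"
    "CL G > 0" "RL G > 0" "PL G > 0" "Vmin G > 0" "Imax G > 0" "Imax G = PL G / Vmin G"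
  using assms unfolding wf_microgrid_def by blast+

lemma state_eqI:
  fixes x y :: "'n::finite state"
  assumes "\<And>k. Ip x k = Ip y k" "\<And>k. Iq x k = Iq y k" "\<And>k. It x k = It y k"
    and "\<And>k. VC x k = VC y k" "VL x = VL y"
  shows "x = y"
proof (rule prod_eqI)
  show "fst x = fst y"
    unfolding vec_eq_iff
  proof
    fix c show "fst x $ c = fst y $ c"
      \<comment> \<open>The second split separates \<open>q\<close> from \<open>t\<close> when
        \<open>c\<close> is an \<open>Inr\<close>; for \<open>Inl\<close> it is harmless.\<close>
      using assms by (cases c; cases "projr c") (auto simp: Ip_def Iq_def It_def)
  qed
  show "snd x = snd y"
    unfolding vec_eq_iff
  proof
    fix w show "snd x $ w = snd y $ w"
      using assms by (cases w) (auto simp: VC_def VL_def)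
  qed
qed

definition mk_state ::
  "('n::finite \<Rightarrow> real) \<Rightarrow> ('n \<Rightarrow> real) \<Rightarrow> ('n \<Rightarrow> real) \<Rightarrow> ('n \<Rightarrow> real) \<Rightarrow> real \<Rightarrow> 'n state" where
  "mk_state p q t c u =
     (\<chi> i. case i of Inl k \<Rightarrow> p k | Inr (Inl k) \<Rightarrow> q k | Inr (Inr k) \<Rightarrow> t k,
      \<chi> w. case w of Inl k \<Rightarrow> c k | Inr _ \<Rightarrow> u)"

lemma mk_state_simps [simp]:
  "Ip (mk_state p q t c u) k = p k" "Iq (mk_state p q t c u) k = q k"
  "It (mk_state p q t c u) k = t k" "VC (mk_state p q t c u) k = c k"
  "VL (mk_state p q t c u) = u"
  by (simp_all add: mk_state_def Ip_def Iq_def It_def VC_def VL_def)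

lemma bounded_linear_components:
  "bounded_linear (\<lambda>x::'n::finite state. Ip x k)" "bounded_linear (\<lambda>x::'n state. Iq x k)"
  "bounded_linear (\<lambda>x::'n state. It x k)" "bounded_linear (\<lambda>x::'n state. VC x k)"
  "bounded_linear (\<lambda>x::'n state. VL x)"
  unfolding Ip_def Iq_def It_def VC_def VL_def
  by (rule bounded_linear_compose [OF bounded_linear_vec_nth bounded_linear_fst]
      bounded_linear_compose [OF bounded_linear_vec_nth bounded_linear_snd])+

lemmas continuous_on_components [continuous_intros] =
  bounded_linear_components [THEN bounded_linear.continuous_on]

lemma component_zero [simp]:
  "Ip 0 k = 0" "Iq 0 k = 0" "It 0 k = 0" "VC 0 k = 0" "VL 0 = 0"
  by (simp_all add: Ip_def Iq_def It_def VC_def VL_def)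

lemma has_real_derivative_components:
  fixes x :: "real \<Rightarrow> 'n::finite state"
  assumes "(x has_vector_derivative dx) F"
  shows "((\<lambda>t. Ip (x t) k) has_real_derivative Ip dx k) F"
    "((\<lambda>t. Iq (x t) k) has_real_derivative Iq dx k) F"
    "((\<lambda>t. It (x t) k) has_real_derivative It dx k) F"
    "((\<lambda>t. VC (x t) k) has_real_derivative VC dx k) F"
    "((\<lambda>t. VL (x t)) has_real_derivative VL dx) F"
  unfolding has_real_derivative_iff_has_vector_derivative
  by (rule bounded_linear_components [THEN bounded_linear.has_vector_derivative] assms)+

section \<open>The constant power load\<close>

text \<open>Since \<open>Imax G = PL G / Vmin G\<close>, the two branches join at
  \<open>Vmin\<close>; this form without cases makes the load visibly Lipschitz.\<close>

lemma load_current_eq: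
  assumes "wf_microgrid G"
  shows "load_current G u = PL G / max (Vmin G) u"
  using wf_microgridD [OF assms] by (auto simp: load_current_def max_def)

lemma load_current_bounds:
  assumes "wf_microgrid G"
  shows "0 \<le> load_current G u" "load_current G u \<le> Imax G"
  using wf_microgridD [OF assms] by (auto simp: load_current_def intro!: divide_left_mono)

text \<open>The constant is the steepest slope of \<open>PL / u\<close> on
  \<open>[Vmin, \<infinity>)\<close>, found at \<open>Vmin\<close>; the truncation by
  \<open>max\<close> does not increase distances.\<close>

lemma lipschitz_load_current:
  assumes "wf_microgrid G"
  shows "(PL G / (Vmin G)\<^sup>2)-lipschitz_on UNIV (load_current G)"
proof (rule lipschitz_onI)
  note pos = wf_microgridD [OF assms]
  fix u w :: real
  define p q where "p = max (Vmin G) u" and "q = max (Vmin G) w"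
  have pq: "p \<ge> Vmin G" "q \<ge> Vmin G" "\<bar>p - q\<bar> \<le> \<bar>u - w\<bar>"
    by (auto simp: p_def q_def max_def)
  have pq0: "p > 0" "q > 0" using pq pos(10) by linarith+
  have "\<bar>PL G / p - PL G / q\<bar> = PL G * \<bar>p - q\<bar> / (p * q)"
  proof -
    have "PL G / p - PL G / q = PL G * (q - p) / (p * q)"
      using pq0 by (simp add: field_simps)
    then show ?thesis
      using pq0 pos(9) by (simp add: abs_mult abs_minus_commute)
  qed
  also have "\<dots> \<le> PL G * \<bar>u - w\<bar> / (Vmin G)\<^sup>2"
    using pq pq0 pos(9,10)
    by (intro frac_le mult_left_mono) (auto simp: power2_eq_square intro!: mult_mono)
  finally show "dist (load_current G u) (load_current G w) \<le> PL G / (Vmin G)\<^sup>2 * dist u w"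
    by (simp add: load_current_eq [OF assms] dist_real_def p_def q_def)
qed (use wf_microgridD [OF assms] in auto)

lemma continuous_on_load_current:
  "wf_microgrid G \<Longrightarrow> continuous_on S (load_current G)"
  using lipschitz_load_current lipschitz_on_continuous_on continuous_on_subset by blast

text \<open>The potential is continuously differentiable across \<open>Vmin\<close>: both branches
  vanish there and the one-sided slopes \<open>Imax\<close> and \<open>PL / Vmin\<close> agree.
  Later arguments need no case distinction on the load.\<close>

lemma DERIV_load_potential:
  assumes "wf_microgrid G"
  shows "(load_potential G has_real_derivative load_current G u) (at u)"
proof -
  note pos = wf_microgridD [OF assms]
  have left: "(load_potential G has_real_derivative load_current G u) (at u within {..Vmin G})"
    if "u \<le> Vmin G"
  proof (rule has_field_derivative_transform_within [OF _ zero_less_one])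
    show "((\<lambda>u. Imax G * (u - Vmin G)) has_real_derivative load_current G u)
        (at u within {..Vmin G})"
      using that pos by (auto simp: load_current_def intro!: derivative_eq_intros)
  qed (use that in \<open>auto simp: load_potential_def\<close>)
  have right: "(load_potential G has_real_derivative load_current G u) (at u within {Vmin G..})"
    if "Vmin G \<le> u"
  proof -
    have "((\<lambda>u. integral {Vmin G..u} (\<lambda>s. PL G / s)) has_real_derivative PL G / u)
        (at u within {Vmin G..u + 1})"
      using that pos by (intro integral_has_real_derivative continuous_intros) auto
    then have "(load_potential G has_real_derivative load_current G u)
        (at u within {Vmin G..u + 1})"
      using that by (elim has_field_derivative_transform_within [OF _ zero_less_one, THEN DERIV_cong])
        (auto simp: load_potential_def load_current_def)
    moreover have "at u within {Vmin G..u + 1} = at u within {Vmin G..}"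
      by (rule at_within_nhd [where S = "{..<u + 1}"]) auto
    ultimately show ?thesis by simp
  qed
  consider "u < Vmin G" | "u = Vmin G" | "Vmin G < u" by linarith
  then show ?thesis
  proof cases
    case 1
    have "(load_potential G has_real_derivative load_current G u) (at u within {..<Vmin G})"
      by (rule DERIV_subset [OF left]) (use 1 in auto)
    with 1 show ?thesis by (simp add: at_within_open [of u "{..<Vmin G}"])
  next
    case 2
    have "(load_potential G has_real_derivative load_current G u)
        (at u within {..Vmin G} \<union> {Vmin G..})"
      using left right 2 unfolding has_field_derivative_iff unfolding at_within_union
      by (simp add: filterlim_sup)
    moreover have "{..Vmin G} \<union> {Vmin G..} = UNIV" by auto
    ultimately show ?thesis by simp
  next
    case 3
    have "(load_potential G has_real_derivative load_current G u) (at u within {Vmin G<..})"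
      by (rule DERIV_subset [OF right]) (use 3 in auto)
    with 3 show ?thesis by (simp add: at_within_open [of u "{Vmin G<..}"])
  qed
qed

text \<open>The slope lies between \<open>0\<close> and \<open>Imax\<close>, so the potential falls
  at most linearly, and only to the left. The quadratic term of the load resistance will outweigh
  this.\<close>

lemma load_potential_lower_bound:
  assumes "wf_microgrid G"
  shows "load_potential G u \<ge> load_potential G 0 - Imax G * \<bar>u\<bar>"
proof -
  have bnd: "\<bar>load_current G z\<bar> \<le> Imax G" for z
    using load_current_bounds [OF assms, of z] by simp
  consider "u = 0" | "u < 0" | "u > 0" by linarith
  then show ?thesis
  proof cases
    case 2
    then obtain z where "load_potential G 0 - load_potential G u = (0 - u) * load_current G z"
      using MVT2 [of u 0 "load_potential G" "load_current G"] DERIV_load_potential [OF assms] by blast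
    moreover have "u * Imax G \<le> u * load_current G z"
      using 2 load_current_bounds [OF assms, of z] by (intro mult_left_mono_neg) auto
    ultimately have "load_potential G 0 + u * Imax G \<le> load_potential G u"
      by (simp add: algebra_simps)
    then show ?thesis using 2 by (simp add: mult.commute)
  next
    case 3
    then obtain z where "load_potential G u - load_potential G 0 = (u - 0) * load_current G z"
      using MVT2 [of 0 u "load_potential G" "load_current G"] DERIV_load_potential [OF assms] by blast
    moreover have "0 \<le> (u - 0) * load_current G z" "0 \<le> Imax G * \<bar>u\<bar>"
      using 3 load_current_bounds [OF assms, of z] wf_microgridD(11) [OF assms] by auto
    ultimately show ?thesis by linarith
  qed simp
qed

section \<open>Equilibria\<close>

text \<open>The \<open>p\<close> and \<open>q\<close> branches in parallel: in steady state both are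
  resistors between \<open>Vref\<close> and the capacitor node.\<close>

definition source_conductance :: "'n microgrid \<Rightarrow> 'n \<Rightarrow> real" where
  "source_conductance G k = 1 / Rp G k + 1 / Rq G k"

text \<open>Kron reduction: the conductance from source to load bus once the capacitor node is
  eliminated.\<close>

definition series_conductance :: "'n microgrid \<Rightarrow> 'n \<Rightarrow> real" where
  "series_conductance G k = source_conductance G k / Rt G k / (source_conductance G k + 1 / Rt G k)"

text \<open>The node voltage at which the capacitor current vanishes, a conductance-weighted mean of
  \<open>Vref\<close> and the load voltage.\<close>

definition bus_voltage :: "'n microgrid \<Rightarrow> real \<Rightarrow> 'n \<Rightarrow> real" where
  "bus_voltage G u k = (source_conductance G k * Vref G k + u / Rt G k) / (source_conductance G k + 1 / Rt G k)"

definition current_mismatch :: "'n::finite microgrid \<Rightarrow> real \<Rightarrow> real" where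
  "current_mismatch G u = load_current G u + u / RL G
     - (\<Sum>k\<in>UNIV. series_conductance G k * (Vref G k - u))"

definition steady_state :: "'n::finite microgrid \<Rightarrow> real \<Rightarrow> 'n state" where
  "steady_state G u = mk_state (\<lambda>k. (Vref G k - bus_voltage G u k) / Rp G k)
     (\<lambda>k. (Vref G k - bus_voltage G u k) / Rq G k) (\<lambda>k. (bus_voltage G u k - u) / Rt G k)
     (bus_voltage G u) u"

lemma source_conductance_pos: "wf_microgrid G \<Longrightarrow> source_conductance G k > 0"
  unfolding source_conductance_def using wf_microgridD by (metis add_pos_pos zero_less_divide_1_iff)

lemma bus_conductance_pos: "wf_microgrid G \<Longrightarrow> source_conductance G k + 1 / Rt G k > 0"
  using source_conductance_pos wf_microgridD by (metis add_pos_pos zero_less_divide_1_iff)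

lemma bus_voltage_iff:
  assumes "wf_microgrid G"
  shows "source_conductance G k * (Vref G k - c) = (c - u) / Rt G k \<longleftrightarrow> c = bus_voltage G u k"
proof -
  have "source_conductance G k * (Vref G k - c) = (c - u) / Rt G k
      \<longleftrightarrow> c * (source_conductance G k + 1 / Rt G k) = source_conductance G k * Vref G k + u / Rt G k"
    using wf_microgridD(3) [OF assms, of k] by (auto simp: field_simps)
  also have "\<dots> \<longleftrightarrow> c = bus_voltage G u k"
    unfolding bus_voltage_def using bus_conductance_pos [OF assms, of k]
    by (subst eq_divide_eq) simp
  finally show ?thesis .
qed

lemma bus_current:
  assumes "wf_microgrid G"
  shows "(bus_voltage G u k - u) / Rt G k = series_conductance G k * (Vref G k - u)"
proof -
  have "bus_voltage G u k - u = source_conductance G k * (Vref G k - u) / (source_conductance G k + 1 / Rt G k)"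
    unfolding bus_voltage_def using bus_conductance_pos [OF assms, of k]
    by (subst divide_diff_eq_iff) (auto simp: algebra_simps)
  then show ?thesis by (simp add: series_conductance_def)
qed

text \<open>Given \<open>VL\<close>, all static equations except the current balance at the load bus
  are linear and uniquely solvable. Only that balance remains, as one scalar equation.\<close>

lemma equilibrium_iff:
  assumes wf: "wf_microgrid G"
  shows "equilibrium G e \<longleftrightarrow> e = steady_state G (VL e) \<and> current_mismatch G (VL e) = 0"
proof
  note pos = wf_microgridD [OF wf]
  assume "equilibrium G e"
  then have e: "\<And>k. Ip e k = (Vref G k - VC e k) / Rp G k"
    "\<And>k. Vref G k - Rq G k * Iq e k - VC e k = 0"
    "\<And>k. VC e k - VL e - Rt G k * It e k = 0"
    "\<And>k. Ip e k + Iq e k - It e k = 0"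
    "(\<Sum>k\<in>UNIV. It e k) - load_current G (VL e) - VL e / RL G = 0"
    by (auto simp: equilibrium_def dynamics_def)
  have q: "Iq e k = (Vref G k - VC e k) / Rq G k" for k
    using e(2) [of k] pos(2) [of k] by (simp add: field_simps)
  have t: "It e k = (VC e k - VL e) / Rt G k" for k
    using e(3) [of k] pos(3) [of k] by (simp add: field_simps)
  have c: "VC e k = bus_voltage G (VL e) k" for k
    unfolding bus_voltage_iff [OF wf, symmetric]
    using e(4) [of k] by (simp add: e(1) q t source_conductance_def distrib_right)
  have "e = steady_state G (VL e)"
    by (rule state_eqI) (auto simp: steady_state_def e(1) q t c)
  moreover have "current_mismatch G (VL e) = 0"
    using e(5) by (simp add: current_mismatch_def t c bus_current [OF wf])
  ultimately show "e = steady_state G (VL e) \<and> current_mismatch G (VL e) = 0" ..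
next
  note pos = wf_microgridD [OF wf]
  assume *: "e = steady_state G (VL e) \<and> current_mismatch G (VL e) = 0"
  define u where "u = VL e"
  have e: "e = steady_state G u" and u: "current_mismatch G u = 0"
    using * by (auto simp: u_def)
  have "(Vref G k - bus_voltage G u k) / Rp G k + (Vref G k - bus_voltage G u k) / Rq G k
      = (bus_voltage G u k - u) / Rt G k" for k
    using bus_voltage_iff [OF wf, of k "bus_voltage G u k" u] by (simp add: source_conductance_def distrib_right)
  moreover have "bus_voltage G u k - u = Rt G k * (series_conductance G k * (Vref G k - u))" for k
    using pos(3) [of k] by (simp flip: bus_current [OF wf])
  ultimately show "equilibrium G e"
    using u
    by (simp add: e equilibrium_def dynamics_def steady_state_def current_mismatch_def
        bus_current [OF wf] less_imp_neq [OF pos(2), symmetric] less_imp_neq [OF pos(3), symmetric])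
qed

text \<open>This is the form in which the conductance enters the slope assumption, which thereby
  reads \<open>net_conductance G - PL G / (VL e)\<^sup>2 \<ge> 0\<close>.\<close>

lemma series_conductance_eq:
  assumes "wf_microgrid G"
  shows "series_conductance G k
    = 1 / Rt G k - 1 / ((Rt G k)\<^sup>2 * (1 / Rp G k + 1 / Rq G k + 1 / Rt G k))"
proof -
  have "1 / ((Rt G k)\<^sup>2 * (source_conductance G k + 1 / Rt G k)) = 1 / Rt G k * (1 / Rt G k) / (source_conductance G k + 1 / Rt G k)"
    by (simp add: power2_eq_square)
  moreover have "a * h / (a + h) = h - h * h / (a + h)" if "a + h > 0" for a h :: real
    using that by (simp add: field_simps)
  from this [OF bus_conductance_pos [OF assms]]
  have "source_conductance G k * (1 / Rt G k) / (source_conductance G k + 1 / Rt G k)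
    = 1 / Rt G k - 1 / Rt G k * (1 / Rt G k) / (source_conductance G k + 1 / Rt G k)" .
  ultimately show ?thesis
    by (simp add: series_conductance_def power2_eq_square flip: source_conductance_def)
qed

section \<open>Sign of the current mismatch\<close>

definition net_conductance :: "'n::finite microgrid \<Rightarrow> real" where
  "net_conductance G = 1 / RL G + (\<Sum>k\<in>UNIV. series_conductance G k)"

lemma net_conductance_pos:
  assumes "wf_microgrid G"
  shows "net_conductance G > 0"
proof -
  note pos = wf_microgridD [OF assms]
  have "series_conductance G k \<ge> 0" for k
    using source_conductance_pos [OF assms, of k] bus_conductance_pos [OF assms, of k] pos(3) [of k]
    by (simp add: series_conductance_def)
  then show ?thesis
    unfolding net_conductance_def using pos(8) by (intro add_pos_nonneg sum_nonneg) auto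
qed

lemma current_mismatch_eq:
  "current_mismatch G u = load_current G u + net_conductance G * u
     - (\<Sum>k\<in>UNIV. series_conductance G k * Vref G k)"
  by (simp add: current_mismatch_def net_conductance_def algebra_simps sum_subtractf
      sum_distrib_left)

lemma continuous_on_current_mismatch:
  assumes "wf_microgrid G"
  shows "continuous_on S (current_mismatch G)"
  unfolding current_mismatch_eq [abs_def]
  by (intro continuous_intros continuous_on_load_current assms)

text \<open>The load current stays between \<open>0\<close> and \<open>Imax\<close>, so the linear
  term, of positive slope, decides the sign far out. The points are asked for beyond a given
  \<open>u\<close> to let the intermediate value theorem start anywhere.\<close>

lemma current_mismatch_large:
  assumes wf: "wf_microgrid G"
  shows "\<exists>a\<le>u. current_mismatch G a \<le> 0" "\<exists>b\<ge>u. current_mismatch G b \<ge> 0"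
proof -
  define n b0 where "n = net_conductance G" and "b0 = (\<Sum>k\<in>UNIV. series_conductance G k * Vref G k)"
  have n: "n > 0" using net_conductance_pos [OF wf] by (simp add: n_def)
  have f: "current_mismatch G v = load_current G v + n * v - b0" for v
    by (simp add: current_mismatch_eq n_def b0_def)
  let ?a = "min u ((b0 - Imax G) / n)"
  have "n * ?a \<le> b0 - Imax G"
    using n by (simp add: min_def field_simps)
  then show "\<exists>a\<le>u. current_mismatch G a \<le> 0"
    using load_current_bounds(2) [OF wf, of ?a] by (intro exI [of _ ?a]) (auto simp: f)
  let ?b = "max u (b0 / n)"
  have "n * ?b \<ge> b0"
    using n by (simp add: max_def field_simps)
  then show "\<exists>b\<ge>u. current_mismatch G b \<ge> 0"
    using load_current_bounds(1) [OF wf, of ?b] by (intro exI [of _ ?b]) (auto simp: f)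
qed

text \<open>On \<open>[Vmin, \<infinity>)\<close> the mismatch is strictly convex, so a second zero would be preceded by one
  with negative slope, which the slope condition forbids.\<close>

lemma current_mismatch_sign:
  assumes wf: "wf_microgrid G"
    and high: "\<And>u. current_mismatch G u = 0 \<Longrightarrow> Vmin G \<le> u"
    and slope: "\<And>u. current_mismatch G u = 0 \<Longrightarrow> PL G / u\<^sup>2 \<le> net_conductance G"
  shows "\<exists>v. current_mismatch G v = 0 \<and> (\<forall>u<v. current_mismatch G u < 0)
    \<and> (\<forall>u>v. current_mismatch G u > 0)"
proof -
  note pos = wf_microgridD [OF wf]
  let ?f = "current_mismatch G"
  have zero: "\<exists>z\<le>b. ?f z = 0" if "?f b \<ge> 0" for b
  proof -
    obtain a where "a \<le> b" "?f a \<le> 0" using current_mismatch_large(1) [OF wf] by blast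
    then show ?thesis
      using IVT' [of ?f a 0 b] that continuous_on_current_mismatch [OF wf] by blast
  qed
  obtain v where v: "?f v = 0"
    using current_mismatch_large(2) [OF wf] zero by blast
  have v0: "v > 0" using high [OF v] pos(10) by linarith
  \<comment> \<open>The secant slope on the convex branch. For \<open>u > z\<close> the quotient
    \<open>PL / (u * z)\<close> is strictly below \<open>PL / z\<^sup>2\<close>, so even a zero of
    slope exactly \<open>0\<close> has positive secants to its right.\<close>
  have secant: "?f u - ?f z = (u - z) * (net_conductance G - PL G / (u * z))"
    if "Vmin G \<le> z" "Vmin G \<le> u" for u z
    using that pos(10) by (simp add: current_mismatch_eq load_current_def field_simps)
  have after: "?f u > 0" if z: "?f z = 0" and "z < u" for z u
  proof -
    have z0: "z > 0" "Vmin G \<le> z" using high [OF z] pos(10) by linarith+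
    have "PL G / (u * z) < PL G / z\<^sup>2"
      using z0 \<open>z < u\<close> pos(9) by (intro divide_strict_left_mono) (auto simp: power2_eq_square)
    then have "net_conductance G - PL G / (u * z) > 0"
      using slope [OF z] by linarith
    then show ?thesis
      using secant [of z u] z z0 \<open>z < u\<close> by simp
  qed
  have "?f u < 0" if "u < v" for u
  proof (rule ccontr)
    assume "\<not> ?f u < 0"
    then obtain z where "z \<le> u" "?f z = 0" using zero [of u] by auto
    then show False using after [of z v] v \<open>u < v\<close> by simp
  qed
  with v after show ?thesis by blast
qed

section \<open>The reduced potential of the load voltage\<close>

text \<open>The value left when the energy is minimised over all coordinates except
  \<open>VL\<close>; its critical points are the load voltages of equilibria.\<close>

definition reduced_potential :: "'n::finite microgrid \<Rightarrow> real \<Rightarrow> real" where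
  "reduced_potential G u = (\<Sum>k\<in>UNIV. series_conductance G k / 2 * (Vref G k - u)\<^sup>2)
     + u\<^sup>2 / (2 * RL G) + load_potential G u"

lemma DERIV_reduced_potential:
  assumes "wf_microgrid G"
  shows "(reduced_potential G has_real_derivative current_mismatch G u) (at u)"
proof -
  have "((\<lambda>u. \<Sum>k\<in>UNIV. series_conductance G k / 2 * (Vref G k - u)\<^sup>2) has_real_derivative
      (\<Sum>k\<in>UNIV. - (series_conductance G k * (Vref G k - u)))) (at u)"
    by (intro DERIV_sum) (auto intro!: derivative_eq_intros simp: field_simps)
  moreover have "((\<lambda>u. u\<^sup>2 / (2 * RL G)) has_real_derivative u / RL G) (at u)"
    using wf_microgridD(8) [OF assms] by (auto intro!: derivative_eq_intros)
  ultimately show ?thesis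
    unfolding reduced_potential_def [abs_def]
    by (intro DERIV_cong [OF DERIV_add [OF DERIV_add DERIV_load_potential [OF assms]]])
      (auto simp: current_mismatch_def sum_negf)
qed

lemma reduced_potential_strict_min:
  assumes wf: "wf_microgrid G"
    and neg: "\<And>u. u < v \<Longrightarrow> current_mismatch G u < 0"
    and pos: "\<And>u. u > v \<Longrightarrow> current_mismatch G u > 0"
    and "u \<noteq> v"
  shows "reduced_potential G v < reduced_potential G u"
proof (cases "u < v")
  case True
  then obtain z where "u < z" "z < v"
    "reduced_potential G v - reduced_potential G u = (v - u) * current_mismatch G z"
    using MVT2 [of u v "reduced_potential G" "current_mismatch G"] DERIV_reduced_potential [OF wf]
    by blast
  moreover have "(v - u) * current_mismatch G z < 0"
    using neg [of z] \<open>u < v\<close> \<open>z < v\<close> by (intro mult_pos_neg) auto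
  ultimately show ?thesis by linarith
next
  case False
  with \<open>u \<noteq> v\<close> have "v < u" by simp
  then obtain z where "v < z" "z < u"
    "reduced_potential G u - reduced_potential G v = (u - v) * current_mismatch G z"
    using MVT2 [of v u "reduced_potential G" "current_mismatch G"] DERIV_reduced_potential [OF wf]
    by blast
  moreover have "(u - v) * current_mismatch G z > 0"
    using pos [of z] \<open>v < u\<close> \<open>v < z\<close> by (intro mult_pos_pos) auto
  ultimately show ?thesis by linarith
qed

section \<open>The energy function\<close>

text \<open>The first three squares measure the distance of the currents from their static values at
  the given voltages. The last two terms are half the power that the resistances dissipate at those
  static values.\<close>

definition branch_energy :: "'n::finite microgrid \<Rightarrow> 'n state \<Rightarrow> 'n \<Rightarrow> real" where
  "branch_energy G x k = Rp G k / 2 * (Ip x k - (Vref G k - VC x k) / Rp G k)\<^sup>2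
     + Rq G k / 2 * (Iq x k - (Vref G k - VC x k) / Rq G k)\<^sup>2
     + Rt G k / 2 * (It x k - (VC x k - VL x) / Rt G k)\<^sup>2
     + source_conductance G k / 2 * (Vref G k - VC x k)\<^sup>2 + 1 / Rt G k / 2 * (VC x k - VL x)\<^sup>2"

text \<open>\<open>P\<^sup>*\<close> after completing the squares in the currents.\<close>

definition energy :: "'n::finite microgrid \<Rightarrow> 'n state \<Rightarrow> real" where
  "energy G x = (\<Sum>k\<in>UNIV. branch_energy G x k) + (VL x)\<^sup>2 / (2 * RL G) + load_potential G (VL x)"

lemma continuous_on_energy:
  fixes G :: "'n::finite microgrid"
  assumes "wf_microgrid G"
  shows "continuous_on UNIV (energy G)"
proof -
  note pos = wf_microgridD [OF assms]
  have "continuous_on UNIV (load_potential G)"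
    using DERIV_load_potential [OF assms] by (meson DERIV_continuous_on)
  then have "continuous_on UNIV (\<lambda>x::'n state. load_potential G (VL x))"
    by (rule continuous_on_compose2) (auto intro: continuous_intros)
  then show ?thesis
    unfolding energy_def [abs_def] branch_energy_def
    using less_imp_neq [OF pos(1), symmetric] less_imp_neq [OF pos(2), symmetric]
      less_imp_neq [OF pos(3), symmetric] pos(8)
    by (auto intro!: continuous_intros)
qed

text \<open>The second completion of squares, now in \<open>VC\<close>: two springs of stiffness
  \<open>g\<close> and \<open>h\<close> pulling towards \<open>Vref\<close> and \<open>VL\<close>
  act as one of stiffness \<open>g + h\<close> at their mean, plus the series spring between the
  ends.\<close>

lemma branch_energy_eq:
  assumes wf: "wf_microgrid G"
  shows "branch_energy G x k = Rp G k / 2 * (Ip x k - (Vref G k - VC x k) / Rp G k)\<^sup>2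
     + Rq G k / 2 * (Iq x k - (Vref G k - VC x k) / Rq G k)\<^sup>2
     + Rt G k / 2 * (It x k - (VC x k - VL x) / Rt G k)\<^sup>2
     + (source_conductance G k + 1 / Rt G k) / 2 * (VC x k - bus_voltage G (VL x) k)\<^sup>2
     + series_conductance G k / 2 * (Vref G k - VL x)\<^sup>2"
proof -
  define g h where "g = source_conductance G k" and "h = 1 / Rt G k"
  \<comment> \<open>The scaled difference \<open>w\<close> gives \<open>Vref = m + h * w\<close> and
    \<open>VL = m - g * w\<close>, which makes the identity polynomial.\<close>
  define m w where "m = bus_voltage G (VL x) k" and "w = (Vref G k - VL x) / (g + h)"
  have gh: "g + h \<noteq> 0"
    using bus_conductance_pos [OF wf, of k] by (simp add: g_def h_def)
  have m: "m = (g * Vref G k + h * VL x) / (g + h)"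
    by (simp add: m_def bus_voltage_def g_def h_def)
  have "m + h * w = (g + h) * Vref G k / (g + h)" "m - g * w = (g + h) * VL x / (g + h)"
    unfolding m w_def times_divide_eq_right add_divide_distrib [symmetric] diff_divide_distrib [symmetric]
    by (simp_all add: algebra_simps)
  then have V: "Vref G k = m + h * w" and u: "VL x = m - g * w"
    using gh by simp_all
  have s: "series_conductance G k * (g + h) = g * h"
    using gh by (simp add: series_conductance_def flip: g_def h_def) (simp add: g_def h_def)
  have "Vref G k - VL x = (g + h) * w"
    by (simp add: V u algebra_simps)
  then have "series_conductance G k * (Vref G k - VL x)\<^sup>2
      = (series_conductance G k * (g + h)) * ((g + h) * w\<^sup>2)"
    by (simp add: power2_eq_square mult_ac)
  then have "series_conductance G k * (Vref G k - VL x)\<^sup>2 = g * h * ((g + h) * w\<^sup>2)"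
    by (simp only: s)
  moreover have "g * (Vref G k - VC x k)\<^sup>2 + h * (VC x k - VL x)\<^sup>2
      = (g + h) * (VC x k - m)\<^sup>2 + g * h * ((g + h) * w\<^sup>2)"
    unfolding V u by algebra
  ultimately have "g * (Vref G k - VC x k)\<^sup>2 + h * (VC x k - VL x)\<^sup>2
      = (g + h) * (VC x k - m)\<^sup>2 + series_conductance G k * (Vref G k - VL x)\<^sup>2"
    by simp
  then show ?thesis
    unfolding branch_energy_def by (simp flip: g_def h_def m_def)
qed

lemma energy_steady_state:
  assumes "wf_microgrid G"
  shows "energy G (steady_state G v) = reduced_potential G v"
  by (simp add: energy_def branch_energy_eq [OF assms] reduced_potential_def steady_state_def)

lemma energy_strict_min:
  assumes wf: "wf_microgrid G"
    and min: "\<And>u. u \<noteq> v \<Longrightarrow> reduced_potential G v < reduced_potential G u"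
    and ne: "x \<noteq> steady_state G v"
  shows "energy G (steady_state G v) < energy G x"
proof -
  note pos = wf_microgridD [OF wf]
  \<comment> \<open>Splits the energy into squares \<open>b k\<close> and the reduced potential. Off
    \<open>VL = v\<close> the latter is strictly larger than its minimum; at \<open>VL = v\<close>
    all \<open>b k\<close> vanish only at the steady state.\<close>
  define b where "b k = branch_energy G x k - series_conductance G k / 2 * (Vref G k - VL x)\<^sup>2" for k
  have b: "b k = Rp G k / 2 * (Ip x k - (Vref G k - VC x k) / Rp G k)\<^sup>2
     + Rq G k / 2 * (Iq x k - (Vref G k - VC x k) / Rq G k)\<^sup>2
     + Rt G k / 2 * (It x k - (VC x k - VL x) / Rt G k)\<^sup>2
     + (source_conductance G k + 1 / Rt G k) / 2 * (VC x k - bus_voltage G (VL x) k)\<^sup>2" for k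
    by (simp add: b_def branch_energy_eq [OF wf])
  note nonneg = less_imp_le [OF pos(1)] less_imp_le [OF pos(2)] less_imp_le [OF pos(3)]
    less_imp_le [OF bus_conductance_pos [OF wf]]
  have b0: "b k \<ge> 0" for k
    unfolding b by (intro add_nonneg_nonneg mult_nonneg_nonneg) (simp_all add: nonneg del: add_nonneg_nonneg)
  have E: "energy G x = (\<Sum>k\<in>UNIV. b k) + reduced_potential G (VL x)"
    by (simp add: energy_def reduced_potential_def b_def sum_subtractf)
  show ?thesis
  proof (cases "VL x = v")
    case False
    then show ?thesis
      using min [of "VL x"] sum_nonneg [of UNIV b] b0 by (simp add: E energy_steady_state [OF wf])
  next
    case True
    have "\<exists>k. b k \<noteq> 0"
    proof (rule ccontr)
      assume "\<nexists>k. b k \<noteq> 0"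
      then have z: "b k = 0" for k by blast
      have parts: "Ip x k = (Vref G k - VC x k) / Rp G k \<and> Iq x k = (Vref G k - VC x k) / Rq G k
          \<and> It x k = (VC x k - VL x) / Rt G k \<and> VC x k = bus_voltage G (VL x) k" for k
      proof -
        have sq: "0 \<le> Rp G k / 2 * (Ip x k - (Vref G k - VC x k) / Rp G k)\<^sup>2"
          "0 \<le> Rq G k / 2 * (Iq x k - (Vref G k - VC x k) / Rq G k)\<^sup>2"
          "0 \<le> Rt G k / 2 * (It x k - (VC x k - VL x) / Rt G k)\<^sup>2"
          "0 \<le> (source_conductance G k + 1 / Rt G k) / 2 * (VC x k - bus_voltage G (VL x) k)\<^sup>2"
          by (intro mult_nonneg_nonneg; simp add: nonneg del: add_nonneg_nonneg)+
        then have "Rp G k / 2 * (Ip x k - (Vref G k - VC x k) / Rp G k)\<^sup>2 = 0"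
          "Rq G k / 2 * (Iq x k - (Vref G k - VC x k) / Rq G k)\<^sup>2 = 0"
          "Rt G k / 2 * (It x k - (VC x k - VL x) / Rt G k)\<^sup>2 = 0"
          "(source_conductance G k + 1 / Rt G k) / 2 * (VC x k - bus_voltage G (VL x) k)\<^sup>2 = 0"
          using z [of k] unfolding b by linarith+
        then show ?thesis
          using pos(1-3) [of k] bus_conductance_pos [OF wf, of k] by auto
      qed
      have "x = steady_state G v"
        using parts by (intro state_eqI) (auto simp: steady_state_def True)
      with ne show False ..
    qed
    then obtain k where "b k > 0" using b0 by (metis less_eq_real_def)
    then have "(\<Sum>k\<in>UNIV. b k) > 0"
      using b0 by (intro sum_pos2 [of UNIV k]) auto
    then show ?thesis by (simp add: E energy_steady_state [OF wf] True)
  qed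
qed

section \<open>Coercivity of the energy\<close>

lemma bounded_image_of_square_bound:
  fixes f :: "'a \<Rightarrow> real"
  assumes "a > 0" and "\<And>x. x \<in> S \<Longrightarrow> a / 2 * (f x)\<^sup>2 \<le> c"
  shows "bounded (f ` S)"
proof -
  have "\<bar>f x\<bar> \<le> 1 + 2 * c / a" if "x \<in> S" for x
  proof -
    have "(f x)\<^sup>2 \<le> 2 * c / a"
      using assms(1) assms(2) [OF that] by (simp add: field_simps)
    moreover have "2 * \<bar>f x\<bar> \<le> 1 + (f x)\<^sup>2"
      using zero_le_power2 [of "\<bar>f x\<bar> - 1"] by (simp add: power2_eq_square algebra_simps)
    ultimately show ?thesis
      by (smt (verit) zero_le_power2)
  qed
  then show ?thesis by (auto simp: bounded_iff)
qed

lemma bounded_stateI: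
  fixes S :: "'n::finite state set"
  assumes "\<And>k. bounded ((\<lambda>x. Ip x k) ` S)" "\<And>k. bounded ((\<lambda>x. Iq x k) ` S)"
    "\<And>k. bounded ((\<lambda>x. It x k) ` S)" "\<And>k. bounded ((\<lambda>x. VC x k) ` S)"
    "bounded (VL ` S)"
  shows "bounded S"
proof -
  have c: "bounded ((\<lambda>x. fst x $ c) ` S)" for c
    using assms(1-3) by (cases c; cases "projr c") (auto simp: Ip_def Iq_def It_def)
  have w: "bounded ((\<lambda>x. snd x $ w) ` S)" for w
    using assms(4,5) by (cases w) (auto simp: VC_def VL_def [abs_def])
  have "\<forall>c. \<exists>B. \<forall>x\<in>S. \<bar>fst x $ c\<bar> \<le> B" "\<forall>w. \<exists>B. \<forall>x\<in>S. \<bar>snd x $ w\<bar> \<le> B"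
    using c w by (auto simp: bounded_iff)
  then obtain B B' where B: "\<And>c x. x \<in> S \<Longrightarrow> \<bar>fst x $ c\<bar> \<le> B c" "\<And>w x. x \<in> S \<Longrightarrow> \<bar>snd x $ w\<bar> \<le> B' w"
    by metis
  have "norm x \<le> sum B UNIV + sum B' UNIV" if "x \<in> S" for x
  proof -
    have "norm x \<le> norm (fst x) + norm (snd x)"
      using norm_Pair_le [of "fst x" "snd x"] by simp
    also have "\<dots> \<le> (\<Sum>c\<in>UNIV. \<bar>fst x $ c\<bar>) + (\<Sum>w\<in>UNIV. \<bar>snd x $ w\<bar>)"
      by (intro add_mono norm_le_l1_cart)
    also have "\<dots> \<le> sum B UNIV + sum B' UNIV"
      using B that by (intro add_mono sum_mono) auto
    finally show ?thesis .
  qed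
  then show ?thesis unfolding bounded_iff by blast
qed

lemma bounded_energy_sublevel:
  fixes G :: "'n::finite microgrid"
  assumes wf: "wf_microgrid G"
  shows "bounded {x. energy G x \<le> c}"
proof -
  note pos = wf_microgridD [OF wf]
  \<comment> \<open>Half of \<open>u\<^sup>2 / (2 * RL)\<close> pays for the linear loss: completing
    the square, \<open>u\<^sup>2 / (4 * RL) - Imax * \<bar>u\<bar>\<close> is at least
    \<open>- RL * Imax\<^sup>2\<close>. The other half controls \<open>VL\<close>.\<close>
  define m where "m = load_potential G 0 - RL G * (Imax G)\<^sup>2"
  define S where "S = {x. energy G x \<le> c}"
  note nonneg = less_imp_le [OF pos(1)] less_imp_le [OF pos(2)] less_imp_le [OF pos(3)]
    less_imp_le [OF source_conductance_pos [OF wf]]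
  have tail: "u\<^sup>2 / (2 * RL G) + load_potential G u \<ge> 1 / (2 * RL G) / 2 * u\<^sup>2 + m" for u
  proof -
    have "0 \<le> RL G * (\<bar>u\<bar> / (2 * RL G) - Imax G)\<^sup>2"
      using pos(8) by simp
    also have "\<dots> = u\<^sup>2 / (4 * RL G) - Imax G * \<bar>u\<bar> + RL G * (Imax G)\<^sup>2"
      using pos(8) by (simp add: power2_eq_square field_simps)
    finally show ?thesis
      using load_potential_lower_bound [OF wf, of u] by (simp add: m_def)
  qed
  have parts: "0 \<le> Rp G k / 2 * (Ip x k - (Vref G k - VC x k) / Rp G k)\<^sup>2"
    "0 \<le> Rq G k / 2 * (Iq x k - (Vref G k - VC x k) / Rq G k)\<^sup>2"
    "0 \<le> Rt G k / 2 * (It x k - (VC x k - VL x) / Rt G k)\<^sup>2"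
    "0 \<le> source_conductance G k / 2 * (Vref G k - VC x k)\<^sup>2" "0 \<le> 1 / Rt G k / 2 * (VC x k - VL x)\<^sup>2" for x k
    by (intro mult_nonneg_nonneg; simp add: nonneg)+
  have br: "0 \<le> branch_energy G x k" for x k
    unfolding branch_energy_def using parts by (intro add_nonneg_nonneg)
  have VL: "1 / (2 * RL G) / 2 * (VL x)\<^sup>2 \<le> c - m" if "x \<in> S" for x
    using that tail [of "VL x"] sum_nonneg [of UNIV "branch_energy G x"] br
    by (simp add: S_def energy_def)
  have branch: "branch_energy G x k \<le> c - m" if "x \<in> S" for x k
  proof -
    have "branch_energy G x k \<le> (\<Sum>k\<in>UNIV. branch_energy G x k)"
      using br by (intro member_le_sum) auto
    moreover have "0 \<le> 1 / (2 * RL G) / 2 * (VL x)\<^sup>2"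
      using pos(8) by simp
    ultimately show ?thesis
      using that tail [of "VL x"] by (simp add: S_def energy_def)
  qed
  have bnd: "Rp G k / 2 * (Ip x k - (Vref G k - VC x k) / Rp G k)\<^sup>2 \<le> c - m"
    "Rq G k / 2 * (Iq x k - (Vref G k - VC x k) / Rq G k)\<^sup>2 \<le> c - m"
    "Rt G k / 2 * (It x k - (VC x k - VL x) / Rt G k)\<^sup>2 \<le> c - m"
    "source_conductance G k / 2 * (Vref G k - VC x k)\<^sup>2 \<le> c - m" if "x \<in> S" for x k
    using branch [OF that, of k] parts [of k x] unfolding branch_energy_def by linarith+
  have bVL: "bounded ((\<lambda>x. VL x) ` S)"
    by (rule bounded_image_of_square_bound [OF _ VL]) (use pos(8) in auto)
  have bVC': "bounded ((\<lambda>x. Vref G k - VC x k) ` S)" for k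
    by (rule bounded_image_of_square_bound [OF source_conductance_pos [OF wf] bnd(4)])
  have const: "bounded ((\<lambda>x. d) ` S)" for d :: real
    by (auto intro: bounded_subset [of "{d}"])
  have scale: "bounded ((\<lambda>x. f x / d) ` S)" if "bounded (f ` S)" for f :: "'n state \<Rightarrow> real" and d
    using bounded_scaleR_comp [OF that, of "1 / d"] by simp
  have bVC: "bounded ((\<lambda>x. VC x k) ` S)" for k
    using bounded_minus_comp [OF const bVC', of "Vref G k" k] by simp
  have bIp: "bounded ((\<lambda>x. Ip x k) ` S)" for k
  proof -
    have "bounded ((\<lambda>x. Ip x k - (Vref G k - VC x k) / Rp G k) ` S)"
      by (rule bounded_image_of_square_bound [OF pos(1) bnd(1)])
    from bounded_plus_comp [OF this scale [OF bVC' [of k], of "Rp G k"]] show ?thesis by simp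
  qed
  have bIq: "bounded ((\<lambda>x. Iq x k) ` S)" for k
  proof -
    have "bounded ((\<lambda>x. Iq x k - (Vref G k - VC x k) / Rq G k) ` S)"
      by (rule bounded_image_of_square_bound [OF pos(2) bnd(2)])
    from bounded_plus_comp [OF this scale [OF bVC' [of k], of "Rq G k"]] show ?thesis by simp
  qed
  have bIt: "bounded ((\<lambda>x. It x k) ` S)" for k
  proof -
    have "bounded ((\<lambda>x. It x k - (VC x k - VL x) / Rt G k) ` S)"
      by (rule bounded_image_of_square_bound [OF pos(3) bnd(3)])
    from bounded_plus_comp [OF this 
        scale [OF bounded_minus_comp [OF bVC [of k] bVL], of "Rt G k"]] show ?thesis by simp
  qed
  show ?thesis
    using bounded_stateI [OF bIp bIq bIt bVC bVL] by (simp add: S_def)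
qed

section \<open>Dissipation\<close>

text \<open>The argument is a velocity, and this is the quadratic form of \<open>L\<close> on its
  currents plus that of \<open>C\<close> on its voltages; \<open>Ip\<close> is absent because its
  inductance is zero.\<close>

definition kinetic :: "'n::finite microgrid \<Rightarrow> 'n state \<Rightarrow> real" where
  "kinetic G y = (\<Sum>k\<in>UNIV. Lq G k * (Iq y k)\<^sup>2 + Lt G k * (It y k)\<^sup>2 + Cb G k * (VC y k)\<^sup>2)
     + CL G * (VL y)\<^sup>2"

text \<open>The bilinear form of \<open>L A^-1 gamma\<close> between current and voltage
  velocities.\<close>

definition coupling :: "'n::finite microgrid \<Rightarrow> 'n state \<Rightarrow> real" where
  "coupling G y = (\<Sum>k\<in>UNIV. Lt G k / Rt G k * It y k * (VC y k - VL y)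
     - Lq G k / Rq G k * Iq y k * VC y k)"

text \<open>The algebraic core of the dissipation identity for one converter, primes denoting
  velocities. The left side is the derivative of \<open>branch_energy\<close>, whose
  \<open>p\<close> square contributes nothing under the constraint.\<close>

lemma branch_power_balance:
  fixes rp rq rt :: real
  assumes "rp > 0" "rq > 0" "rt > 0"
    and q': "lq * q' = V - rq * q - c" and t': "lt * t' = c - u - rt * t"
    and c': "cb * c' = (V - c) / rp + q - t"
  shows "rq * (q - (V - c) / rq) * (q' + c' / rq) + rt * (t - (c - u) / rt) * (t' - (c' - u') / rt)
      - (1 / rp + 1 / rq) * (V - c) * c' + 1 / rt * (c - u) * (c' - u')
    = - (lq * q'\<^sup>2 + lt * t'\<^sup>2 + cb * c'\<^sup>2)
      + 2 * (lt / rt * t' * (c' - u') - lq / rq * q' * c') - t * u'"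
proof -
  \<comment> \<open>Each circuit law is multiplied by a velocity, after which the claim no longer
    contains \<open>lq\<close>, \<open>lt\<close> or \<open>cb\<close>.\<close>
  have "lq * q'\<^sup>2 = (V - rq * q - c) * q'" "lt * t'\<^sup>2 = (c - u - rt * t) * t'"
    "cb * c'\<^sup>2 = ((V - c) / rp + q - t) * c'"
    "lq / rq * q' * c' = (V - rq * q - c) / rq * c'"
    "lt / rt * t' * (c' - u') = (c - u - rt * t) / rt * (c' - u')"
    by (simp_all add: power2_eq_square flip: q' t' c')
  then show ?thesis
    using assms(1-3) by (simp only:) (simp add: field_simps)
qed

lemma has_real_derivative_energy:
  fixes G :: "'n::finite microgrid"
  assumes wf: "wf_microgrid G"
    and x: "(x has_vector_derivative dx) (at t within S)"
    and dyn: "dynamics G (x t) dx"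
  shows "((\<lambda>t. energy G (x t)) has_real_derivative - kinetic G dx + 2 * coupling G dx) (at t within S)"
proof -
  note pos = wf_microgridD [OF wf]
  note d = has_real_derivative_components [OF x]
  let ?c = "\<lambda>k. VC (x t) k" and ?u = "VL (x t)"
  have eqs: "\<And>k. Ip (x t) k = (Vref G k - VC (x t) k) / Rp G k"
    "\<And>k. Lq G k * Iq dx k = Vref G k - Rq G k * Iq (x t) k - VC (x t) k"
    "\<And>k. Lt G k * It dx k = VC (x t) k - VL (x t) - Rt G k * It (x t) k"
    "\<And>k. Cb G k * VC dx k = (Vref G k - VC (x t) k) / Rp G k + Iq (x t) k - It (x t) k"
    "CL G * VL dx = (\<Sum>k\<in>UNIV. It (x t) k) - load_current G (VL (x t)) - VL (x t) / RL G"
    using dyn by (auto simp: dynamics_def)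
  have branch: "((\<lambda>t. branch_energy G (x t) k) has_real_derivative
      - (Lq G k * (Iq dx k)\<^sup>2 + Lt G k * (It dx k)\<^sup>2 + Cb G k * (VC dx k)\<^sup>2)
      + 2 * (Lt G k / Rt G k * It dx k * (VC dx k - VL dx) - Lq G k / Rq G k * Iq dx k * VC dx k)
      - It (x t) k * VL dx) (at t within S)" for k
  proof -
    have sq: "((\<lambda>t. a / 2 * (f t)\<^sup>2) has_real_derivative a * f t * f') (at t within S)"
      if "(f has_real_derivative f') (at t within S)" for a f f'
      using that by (auto intro!: derivative_eq_intros)
    have "((\<lambda>t. branch_energy G (x t) k) has_real_derivative
        Rp G k * (Ip (x t) k - (Vref G k - ?c k) / Rp G k) * (Ip dx k - (0 - VC dx k) / Rp G k)
        + Rq G k * (Iq (x t) k - (Vref G k - ?c k) / Rq G k) * (Iq dx k - (0 - VC dx k) / Rq G k)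
        + Rt G k * (It (x t) k - (?c k - ?u) / Rt G k) * (It dx k - (VC dx k - VL dx) / Rt G k)
        + source_conductance G k * (Vref G k - ?c k) * (0 - VC dx k)
        + 1 / Rt G k * (?c k - ?u) * (VC dx k - VL dx)) (at t within S)"
      unfolding branch_energy_def
      by (intro DERIV_add sq DERIV_diff DERIV_cdivide DERIV_const d)
    then show ?thesis
      using branch_power_balance [OF pos(1) pos(2) pos(3) eqs(2) eqs(3) eqs(4), of k "VL dx"]
      by (elim DERIV_cong) (simp add: eqs(1) source_conductance_def)
  qed
  have "((\<lambda>t. (VL (x t))\<^sup>2 / (2 * RL G)) has_real_derivative VL (x t) / RL G * VL dx) (at t within S)"
    using d(5) pos(8) by (auto intro!: derivative_eq_intros)
  moreover have "((\<lambda>t. load_potential G (VL (x t))) has_real_derivative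
      load_current G (VL (x t)) * VL dx) (at t within S)"
    by (rule DERIV_chain2 [OF DERIV_load_potential [OF wf] d(5)])
  ultimately have "((\<lambda>t. energy G (x t)) has_real_derivative
      (\<Sum>k\<in>UNIV. - (Lq G k * (Iq dx k)\<^sup>2 + Lt G k * (It dx k)\<^sup>2 + Cb G k * (VC dx k)\<^sup>2)
        + 2 * (Lt G k / Rt G k * It dx k * (VC dx k - VL dx) - Lq G k / Rq G k * Iq dx k * VC dx k)
        - It (x t) k * VL dx)
      + VL (x t) / RL G * VL dx + load_current G (VL (x t)) * VL dx) (at t within S)"
    unfolding energy_def by (intro DERIV_add DERIV_sum branch)
  \<comment> \<open>The load bus equation supplies the missing term of \<open>kinetic\<close> and
    cancels the leftovers \<open>- It * VL'\<close> of the branches.\<close>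
  moreover have "VL (x t) / RL G * VL dx + load_current G (VL (x t)) * VL dx
      = (\<Sum>k\<in>UNIV. It (x t) k) * VL dx - CL G * (VL dx)\<^sup>2"
    unfolding power2_eq_square mult.assoc [symmetric] eqs(5) by (simp add: algebra_simps)
  ultimately show ?thesis
    by (elim DERIV_cong) (simp add: kinetic_def coupling_def sum.distrib sum_subtractf
        sum_negf sum_distrib_left sum_distrib_right)
qed

lemma gamma_mat_vector:
  "(gamma_mat *v z) $ Inl k = - (z $ Inl k)" "(gamma_mat *v z) $ Inr (Inl k) = - (z $ Inl k)"
  "(gamma_mat *v z) $ Inr (Inr k) = z $ Inl k - z $ Inr ()"
  by (simp_all add: gamma_mat_def matrix_vector_mult_def sum_UNIV_sum_type UNIV_unit
      if_distrib [of "\<lambda>a. a * _"] cong: if_cong)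

text \<open>For \<open>a = L^(1/2) z\<close> and \<open>b = C^(1/2) v\<close> the coupling is the
  inner product of \<open>a\<close> with \<open>B *v b\<close>, and \<open>kinetic\<close> is the
  sum of the squared norms. Cauchy-Schwarz and the arithmetic-geometric mean inequality finish. Only
  the root of \<open>L\<close> occurs, never its inverse, so its zero entries do no harm.\<close>

lemma coupling_le_kinetic:
  fixes G :: "'n::finite microgrid"
  assumes wf: "wf_microgrid G"
    and sig: "sigma_max (L_sqrt G ** matrix_inv (A_mat G) ** gamma_mat ** C_inv_sqrt G) < 1"
  shows "\<exists>s<1. \<forall>y. 2 * coupling G y \<le> s * kinetic G y"
proof -
  note pos = wf_microgridD [OF wf]
  define B where "B = L_sqrt G ** matrix_inv (A_mat G) ** gamma_mat ** C_inv_sqrt G"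
  obtain s where s: "0 \<le> s" "s < 1" "\<And>v. norm (B *v v) \<le> s * norm v"
    using sigma_max_bound sig unfolding B_def by blast
  have apos: "a_diag G c \<noteq> 0" "l_diag G c \<ge> 0" for c
    using pos(1-5)[THEN less_imp_le] less_imp_neq [OF pos(1), symmetric]
      less_imp_neq [OF pos(2), symmetric] less_imp_neq [OF pos(3), symmetric]
    by (auto simp: a_diag_def l_diag_def split: sum.split)
  have cpos: "c_diag G w > 0" for w
    using pos by (auto simp: c_diag_def split: sum.split)
  have "2 * coupling G y \<le> s * kinetic G y" for y
  proof -
    define a where "a = L_sqrt G *v fst y"
    define b where "b = diag_mat (\<lambda>w. sqrt (c_diag G w)) *v snd y"
    have "C_inv_sqrt G *v b = snd y"
      using cpos [THEN less_imp_neq]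
      by (simp add: b_def C_inv_sqrt_def vec_eq_iff diag_mat_vector less_imp_neq [OF cpos, symmetric])
    then have "B *v b = L_sqrt G *v (matrix_inv (A_mat G) *v (gamma_mat *v snd y))"
      by (simp add: B_def flip: matrix_vector_mul_assoc)
    then have Bb: "(B *v b) $ c = sqrt (l_diag G c) / a_diag G c * (gamma_mat *v snd y) $ c" for c
      unfolding A_mat_def L_sqrt_def by (simp add: matrix_inv_diag_mat apos diag_mat_vector)
    have "a \<bullet> (B *v b) = (\<Sum>c\<in>UNIV. l_diag G c / a_diag G c * fst y $ c * (gamma_mat *v snd y) $ c)"
      unfolding inner_vec_def Bb a_def L_sqrt_def diag_mat_vector
      by (intro sum.cong refl) (simp add: apos)
    also have "\<dots> = coupling G y"
      by (simp add: sum_UNIV_sum_type gamma_mat_vector l_diag_def a_diag_def coupling_def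
          Iq_def It_def VC_def VL_def sum_subtractf sum_negf)
    finally have "coupling G y \<le> norm a * norm (B *v b)"
      using norm_cauchy_schwarz by metis
    also have "\<dots> \<le> norm a * (s * norm b)"
      by (intro mult_left_mono s) auto
    finally have "2 * coupling G y \<le> s * (2 * norm a * norm b)"
      by (simp add: mult_ac)
    also have "\<dots> \<le> s * ((norm a)\<^sup>2 + (norm b)\<^sup>2)"
      using s(1) sum_squares_bound by (intro mult_left_mono)
    also have "(norm a)\<^sup>2 + (norm b)\<^sup>2 = kinetic G y"
    proof -
      have "(norm a)\<^sup>2 = (\<Sum>c\<in>UNIV. l_diag G c * (fst y $ c)\<^sup>2)"
        unfolding power2_norm_eq_inner inner_vec_def a_def L_sqrt_def diag_mat_vector
        by (intro sum.cong refl) (simp add: apos power2_eq_square)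
      moreover have "(norm b)\<^sup>2 = (\<Sum>w\<in>UNIV. c_diag G w * (snd y $ w)\<^sup>2)"
        unfolding power2_norm_eq_inner inner_vec_def b_def diag_mat_vector
        by (intro sum.cong refl) (simp add: less_imp_le [OF cpos] power2_eq_square)
      ultimately show ?thesis
        by (simp add: sum_UNIV_sum_type l_diag_def c_diag_def kinetic_def UNIV_unit
            Iq_def It_def VC_def VL_def sum.distrib)
    qed
    finally show ?thesis .
  qed
  with s(2) show ?thesis by blast
qed

section \<open>The dynamics as a Lipschitz differential equation\<close>

definition consistent :: "'n::finite microgrid \<Rightarrow> 'n state \<Rightarrow> bool" where
  "consistent G x \<longleftrightarrow> (\<forall>k. Ip x k = (Vref G k - VC x k) / Rp G k)"

text \<open>Differentiating the algebraic equation turns it into an equation for \<open>Ip\<close> that conserves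
  \<open>Ip + VC / Rp\<close>.\<close>

definition vfield :: "'n::finite microgrid \<Rightarrow> 'n state \<Rightarrow> 'n state" where
  "vfield G x = mk_state
     (\<lambda>k. - (((Vref G k - VC x k) / Rp G k + Iq x k - It x k) / Cb G k) / Rp G k)
     (\<lambda>k. (Vref G k - Rq G k * Iq x k - VC x k) / Lq G k)
     (\<lambda>k. (VC x k - VL x - Rt G k * It x k) / Lt G k)
     (\<lambda>k. ((Vref G k - VC x k) / Rp G k + Iq x k - It x k) / Cb G k)
     (((\<Sum>k\<in>UNIV. It x k) - load_current G (VL x) - VL x / RL G) / CL G)"

text \<open>\<open>dynamics\<close> alone leaves the velocity of \<open>Ip\<close> free; the extra
  conjunct is the differentiated constraint that fixes it.\<close>

lemma dynamics_vfield_iff: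
  assumes "wf_microgrid G"
  shows "dynamics G x dx \<and> (\<forall>k. Ip dx k = - VC dx k / Rp G k)
    \<longleftrightarrow> consistent G x \<and> dx = vfield G x" (is "?L \<longleftrightarrow> ?R")
proof
  note pos = wf_microgridD [OF assms]
  have solve: "a * y = b \<Longrightarrow> a > 0 \<Longrightarrow> y = b / a" for a b y :: real
    by (auto simp: field_simps)
  {
    assume ?L
    then have con: "consistent G x"
      by (simp add: dynamics_def consistent_def)
    from \<open>?L\<close> have eqs: "\<And>k. Lq G k * Iq dx k = Vref G k - Rq G k * Iq x k - VC x k"
      "\<And>k. Lt G k * It dx k = VC x k - VL x - Rt G k * It x k"
      "\<And>k. Cb G k * VC dx k = (Vref G k - VC x k) / Rp G k + Iq x k - It x k"
      "CL G * VL dx = (\<Sum>k\<in>UNIV. It x k) - load_current G (VL x) - VL x / RL G"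
      "\<And>k. Ip dx k = - VC dx k / Rp G k"
      by (auto simp: dynamics_def)
    have "dx = vfield G x"
      by (rule state_eqI) (auto simp: vfield_def eqs(5) solve [OF eqs(1) pos(4)]
          solve [OF eqs(2) pos(5)] solve [OF eqs(3) pos(6)] solve [OF eqs(4) pos(7)])
    with con show ?R ..
  }
  assume ?R
  then show ?L
    using less_imp_neq [OF pos(4), symmetric] less_imp_neq [OF pos(5), symmetric]
      less_imp_neq [OF pos(6), symmetric] pos(7)
    by (simp add: dynamics_def consistent_def vfield_def)
qed

text \<open>\<open>kinetic\<close> does not see the velocity of \<open>Ip\<close>, but
  \<open>vfield\<close> ties it to that of \<open>VC\<close>. Consistency has to be assumed because
  \<open>vfield\<close> never looks at \<open>Ip\<close>.\<close>

lemma consistent_vfield_zero: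
  assumes wf: "wf_microgrid G" and "consistent G x" and "kinetic G (vfield G x) = 0"
  shows "equilibrium G x"
proof -
  note pos = wf_microgridD [OF wf]
  let ?y = "vfield G x"
  have sq: "0 \<le> Lq G k * (Iq ?y k)\<^sup>2" "0 \<le> Lt G k * (It ?y k)\<^sup>2"
    "0 \<le> Cb G k * (VC ?y k)\<^sup>2" "0 \<le> CL G * (VL ?y)\<^sup>2" for k
    using pos(4-6) [of k] pos(7) by auto
  have "0 \<le> (\<Sum>k\<in>UNIV. Lq G k * (Iq ?y k)\<^sup>2 + Lt G k * (It ?y k)\<^sup>2 + Cb G k * (VC ?y k)\<^sup>2)"
    using sq by (intro sum_nonneg add_nonneg_nonneg)
  with assms(3) sq(4) have "CL G * (VL ?y)\<^sup>2 = 0"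
    and "(\<Sum>k\<in>UNIV. Lq G k * (Iq ?y k)\<^sup>2 + Lt G k * (It ?y k)\<^sup>2 + Cb G k * (VC ?y k)\<^sup>2) = 0"
    unfolding kinetic_def by linarith+
  then have VL: "VL ?y = 0"
    and s: "Lq G k * (Iq ?y k)\<^sup>2 + Lt G k * (It ?y k)\<^sup>2 + Cb G k * (VC ?y k)\<^sup>2 = 0" for k
    using pos(7) sq(1-3) by (auto simp: sum_nonneg_eq_0_iff add_nonneg_nonneg)
  have comps: "Iq ?y k = 0 \<and> It ?y k = 0 \<and> VC ?y k = 0" for k
  proof -
    have "Lq G k * (Iq ?y k)\<^sup>2 = 0" "Lt G k * (It ?y k)\<^sup>2 = 0" "Cb G k * (VC ?y k)\<^sup>2 = 0"
      using s [of k] sq(1-3) [of k] by linarith+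
    then show ?thesis
      using pos(4-6) [of k] by auto
  qed
  have "dynamics G x ?y" "\<And>k. Ip ?y k = - VC ?y k / Rp G k"
    using dynamics_vfield_iff [OF wf, of x ?y] assms(2) by auto
  moreover from this have "?y = 0"
    by (intro state_eqI) (simp_all add: comps VL)
  ultimately show ?thesis by (simp add: equilibrium_def)
qed

section \<open>Globally Lipschitz maps, with constants hidden so that closure rules compose\<close>

definition lipschitz :: "('a::metric_space \<Rightarrow> 'b::metric_space) \<Rightarrow> bool" where
  "lipschitz f \<longleftrightarrow> (\<exists>K. K-lipschitz_on UNIV f)"

lemma lipschitz_const: "lipschitz (\<lambda>x. c)"
  unfolding lipschitz_def using lipschitz_on_constant by blast

lemma lipschitz_add:
  fixes f g :: "'a::metric_space \<Rightarrow> 'b::real_normed_vector"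
  shows "lipschitz f \<Longrightarrow> lipschitz g \<Longrightarrow> lipschitz (\<lambda>x. f x + g x)"
  unfolding lipschitz_def using lipschitz_on_add by blast

lemma lipschitz_diff:
  fixes f g :: "'a::metric_space \<Rightarrow> 'b::real_normed_vector"
  shows "lipschitz f \<Longrightarrow> lipschitz g \<Longrightarrow> lipschitz (\<lambda>x. f x - g x)"
  unfolding lipschitz_def using lipschitz_on_diff by blast

lemma lipschitz_uminus:
  fixes f :: "'a::metric_space \<Rightarrow> 'b::real_normed_vector"
  shows "lipschitz f \<Longrightarrow> lipschitz (\<lambda>x. - f x)"
  unfolding lipschitz_def using lipschitz_on_minus by blast

lemma lipschitz_cmult:
  fixes f :: "'a::metric_space \<Rightarrow> real"
  shows "lipschitz f \<Longrightarrow> lipschitz (\<lambda>x. a * f x)"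
  unfolding lipschitz_def using lipschitz_on_cmult_real by blast

lemma lipschitz_divide:
  fixes f :: "'a::metric_space \<Rightarrow> real"
  shows "lipschitz f \<Longrightarrow> lipschitz (\<lambda>x. f x / a)"
  using lipschitz_cmult [of f "1 / a"] by simp

lemma lipschitz_sum:
  fixes f :: "'i \<Rightarrow> 'a::metric_space \<Rightarrow> 'b::real_normed_vector"
  shows "(\<And>i. i \<in> I \<Longrightarrow> lipschitz (f i)) \<Longrightarrow> lipschitz (\<lambda>x. \<Sum>i\<in>I. f i x)"
  by (induction I rule: infinite_finite_induct) (auto intro: lipschitz_const lipschitz_add)

lemma lipschitz_bounded_linear:
  assumes "bounded_linear f"
  shows "lipschitz f"
proof -
  interpret bounded_linear f by fact
  show ?thesis unfolding lipschitz_def using lipschitz_boundE by blast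
qed

lemma lipschitz_compose:
  assumes "lipschitz f" "lipschitz g"
  shows "lipschitz (\<lambda>x. g (f x))"
proof -
  obtain K M where "K-lipschitz_on UNIV f" "M-lipschitz_on UNIV g"
    using assms by (auto simp: lipschitz_def)
  then have "(M * K)-lipschitz_on UNIV (g \<circ> f)"
    by (intro lipschitz_on_compose) (auto intro: lipschitz_on_subset)
  then show ?thesis by (auto simp: lipschitz_def o_def)
qed

lemma lipschitz_vec_lambda:
  fixes f :: "'a::metric_space \<Rightarrow> 'i::finite \<Rightarrow> real"
  assumes "\<And>i. lipschitz (\<lambda>x. f x i)"
  shows "lipschitz (\<lambda>x. \<chi> i. f x i)"
proof -
  have "\<forall>i. \<exists>K. K-lipschitz_on UNIV (\<lambda>x. f x i)"
    using assms by (simp add: lipschitz_def)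
  then obtain K where K: "\<And>i. (K i)-lipschitz_on UNIV (\<lambda>x. f x i)"
    by metis
  have "(\<Sum>i\<in>UNIV. K i)-lipschitz_on UNIV (\<lambda>x. \<chi> i. f x i)"
  proof (rule lipschitz_onI)
    fix x y
    have "dist (\<chi> i. f x i) (\<chi> i. f y i) \<le> (\<Sum>i\<in>UNIV. dist (f x i) (f y i))"
      using norm_le_l1_cart [of "(\<chi> i. f x i) - (\<chi> i. f y i)"] by (simp add: dist_norm)
    also have "\<dots> \<le> (\<Sum>i\<in>UNIV. K i * dist x y)"
      by (intro sum_mono lipschitz_onD [OF K]) auto
    finally show "dist (\<chi> i. f x i) (\<chi> i. f y i) \<le> (\<Sum>i\<in>UNIV. K i) * dist x y"
      by (simp add: sum_distrib_right)
  qed (intro sum_nonneg lipschitz_on_nonneg [OF K])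
  then show ?thesis by (auto simp: lipschitz_def)
qed

lemma lipschitz_mk_state:
  assumes "\<And>k. lipschitz (\<lambda>x. p x k)" "\<And>k. lipschitz (\<lambda>x. q x k)" "\<And>k. lipschitz (\<lambda>x. t x k)"
    "\<And>k. lipschitz (\<lambda>x. c x k)" "lipschitz u"
  shows "lipschitz (\<lambda>x. mk_state (p x) (q x) (t x) (c x) (u x))"
proof -
  have "lipschitz (\<lambda>x. \<chi> i. case i of Inl k \<Rightarrow> p x k | Inr (Inl k) \<Rightarrow> q x k | Inr (Inr k) \<Rightarrow> t x k)"
  proof (rule lipschitz_vec_lambda)
    fix i
    show "lipschitz (\<lambda>x. case i of Inl k \<Rightarrow> p x k | Inr (Inl k) \<Rightarrow> q x k | Inr (Inr k) \<Rightarrow> t x k)"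
      by (cases i; cases "projr i") (auto intro: assms)
  qed
  moreover have "lipschitz (\<lambda>x. \<chi> w. case w of Inl k \<Rightarrow> c x k | Inr _ \<Rightarrow> u x)"
  proof (rule lipschitz_vec_lambda)
    fix w
    show "lipschitz (\<lambda>x. case w of Inl k \<Rightarrow> c x k | Inr _ \<Rightarrow> u x)"
      by (cases w) (auto intro: assms)
  qed
  ultimately show ?thesis
    unfolding mk_state_def lipschitz_def using lipschitz_on_Pair by blast
qed

lemma lipschitz_vfield:
  fixes G :: "'n::finite microgrid"
  assumes "wf_microgrid G"
  shows "lipschitz (vfield G)"
proof -
  have "lipschitz (load_current G)"
    using lipschitz_load_current [OF assms] by (auto simp: lipschitz_def)
  then have load: "lipschitz (\<lambda>x::'n state. load_current G (VL x))"
    by (rule lipschitz_compose [OF lipschitz_bounded_linear [OF bounded_linear_components(5)]])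
  show ?thesis
    unfolding vfield_def [abs_def]
    by (intro lipschitz_mk_state lipschitz_divide lipschitz_diff lipschitz_add lipschitz_uminus
        lipschitz_cmult lipschitz_sum lipschitz_const load
        bounded_linear_components [THEN lipschitz_bounded_linear])
qed

section \<open>Trajectories\<close>

text \<open>The constraint holds throughout \<open>S\<close> and can be differentiated along
  \<open>S\<close>. As \<open>S\<close> is a nondegenerate interval, derivatives within it are
  unique, which determines the velocity of \<open>Ip\<close>.\<close>

lemma solution_on_imp_vfield:
  assumes wf: "wf_microgrid G" and S: "forward_interval S" and sol: "solution_on G S x"
    and t: "t \<in> S"
  shows "consistent G (x t)" "(x has_vector_derivative vfield G (x t)) (at t within S)"
proof -
  have con: "consistent G (x s)" if "s \<in> S" for s
    using sol that by (auto simp: solution_on_def dynamics_def consistent_def)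
  then show "consistent G (x t)" using t .
  obtain dx where dx: "(x has_vector_derivative dx) (at t within S)" "dynamics G (x t) dx"
    using sol t by (auto simp: solution_on_def)
  have "\<nexists>a. S = {a}"
    using S by (auto simp: forward_interval_def)
  moreover have "connected S"
    using S by (simp add: forward_interval_def is_interval_connected_1)
  ultimately have "t islimpt S"
    using t by (intro connected_imp_perfect) auto
  then have nt: "at t within S \<noteq> bot"
    by (simp add: trivial_limit_within)
  have "Ip dx k = - VC dx k / Rp G k" for k
  proof (rule vector_derivative_unique_within [OF nt])
    show "((\<lambda>s. Ip (x s) k) has_vector_derivative Ip dx k) (at t within S)"
      using has_real_derivative_components(1) [OF dx(1)]
      by (simp add: has_real_derivative_iff_has_vector_derivative)
    have "((\<lambda>s. (Vref G k - VC (x s) k) / Rp G k) has_real_derivative (0 - VC dx k) / Rp G k)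
        (at t within S)"
      by (intro DERIV_cdivide DERIV_diff DERIV_const has_real_derivative_components dx)
    then have "((\<lambda>s. Ip (x s) k) has_real_derivative - VC dx k / Rp G k) (at t within S)"
      using con by (elim has_field_derivative_transform_within [OF _ zero_less_one t, THEN DERIV_cong])
        (auto simp: consistent_def)
    then show "((\<lambda>s. Ip (x s) k) has_vector_derivative - VC dx k / Rp G k) (at t within S)"
      by (simp add: has_real_derivative_iff_has_vector_derivative)
  qed
  with dx show "(x has_vector_derivative vfield G (x t)) (at t within S)"
    using dynamics_vfield_iff [OF wf, of "x t" dx] by simp
qed

lemma solution_on_atLeast_exists:
  assumes wf: "wf_microgrid G" and x0: "consistent G x0"
  shows "\<exists>x. x 0 = x0 \<and> solution_on G {0..} x"
proof -
  obtain K where "K-lipschitz_on UNIV (vfield G)"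
    using lipschitz_vfield [OF wf] by (auto simp: lipschitz_def)
  then obtain x where x: "x 0 = x0"
    "\<And>t. 0 \<le> t \<Longrightarrow> (x has_vector_derivative vfield G (x t)) (at t within {0..})"
    using lipschitz_ode_solution_exists by metis
  have con: "consistent G (x t)" if "0 \<le> t" for t
    unfolding consistent_def
  proof
    fix k
    have "\<exists>c. \<forall>s\<in>{0..}. Ip (x s) k + VC (x s) k / Rp G k = c"
    proof (rule has_field_derivative_zero_constant)
      fix s :: real assume "s \<in> {0..}"
      then have "((\<lambda>s. Ip (x s) k + VC (x s) k / Rp G k) has_real_derivative
          Ip (vfield G (x s)) k + VC (vfield G (x s)) k / Rp G k) (at s within {0..})"
        by (intro DERIV_add DERIV_cdivide has_real_derivative_components x) auto
      then show "((\<lambda>s. Ip (x s) k + VC (x s) k / Rp G k) has_real_derivative 0) (at s within {0..})"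
        by (simp add: vfield_def)
    qed auto
    then have "Ip (x t) k + VC (x t) k / Rp G k = Ip (x 0) k + VC (x 0) k / Rp G k"
      using that by force
    then show "Ip (x t) k = (Vref G k - VC (x t) k) / Rp G k"
      using x0 by (simp add: x(1) consistent_def diff_divide_distrib)
  qed
  have "solution_on G {0..} x"
    unfolding solution_on_def using x(2) con dynamics_vfield_iff [OF wf] by (metis atLeast_iff)
  with x(1) show ?thesis by blast
qed

text \<open>By uniqueness the global solution from the same consistent initial state extends
  \<open>x\<close>; maximality then leaves no room for a smaller domain.\<close>

lemma trajectory_domain:
  assumes wf: "wf_microgrid G" and tr: "trajectory G S x"
  shows "S = {0..}"
proof -
  have S: "forward_interval S" and sol: "solution_on G S x"
    using tr by (auto simp: trajectory_def)
  have S': "is_interval S" "0 \<in> S" "S \<subseteq> {0..}"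
    using S by (auto simp: forward_interval_def)
  have H: "forward_interval {0..}"
  proof -
    have "{0..} \<noteq> {0::real}"
      by (metis atLeast_iff singletonD zero_le_one zero_neq_one)
    then show ?thesis by (simp add: forward_interval_def is_interval_ci)
  qed
  obtain y where y: "y 0 = x 0" "solution_on G {0..} y"
    using solution_on_atLeast_exists [OF wf solution_on_imp_vfield(1) [OF wf S sol S'(2)]] by blast
  obtain K where K: "K-lipschitz_on UNIV (vfield G)"
    using lipschitz_vfield [OF wf] by (auto simp: lipschitz_def)
  have "y t = x t" if "t \<in> S" for t
  proof (rule lipschitz_ode_solution_unique [where x = y and y = x, OF K S' _ _ y(1) that])
    fix s assume s: "s \<in> S"
    then show "(x has_vector_derivative vfield G (x s)) (at s within S)"
      by (rule solution_on_imp_vfield(2) [OF wf S sol])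
    have "(y has_vector_derivative vfield G (y s)) (at s within {0..})"
      using s S'(3) by (intro solution_on_imp_vfield(2) [OF wf H y(2)]) auto
    then show "(y has_vector_derivative vfield G (y s)) (at s within S)"
      using S'(3) by (rule has_vector_derivative_within_subset)
  qed
  moreover from tr have "forward_interval {0..} \<and> solution_on G {0..} y \<and> S \<subseteq> {0..}
      \<and> (\<forall>t\<in>S. y t = x t) \<longrightarrow> {0..} = S"
    unfolding trajectory_def by blast
  ultimately show ?thesis using H y(2) S'(3) by blast
qed

theorem mainTheorem1:
  fixes G :: "'n::finite microgrid"
  assumes "wf_microgrid G"
    and "\<forall>e. equilibrium G e \<longrightarrow> VL e \<ge> Vmin G"
    and "filterlim (modified_potential G) at_top at_infinity"
    and "sigma_max (L_sqrt G ** matrix_inv (A_mat G) ** gamma_mat ** C_inv_sqrt G) < 1"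
    and "\<forall>e. equilibrium G e \<longrightarrow>
           1 / RL G - PL G / (VL e)\<^sup>2 + (\<Sum>k\<in>UNIV. 1 / Rt G k)
           - (\<Sum>k\<in>UNIV. 1 / ((Rt G k)\<^sup>2 * (1 / Rp G k + 1 / Rq G k + 1 / Rt G k))) \<ge> 0"
  shows "globally_asymptotically_stable G"
proof -
  note wf = assms(1)
  note pos = wf_microgridD [OF wf]
  have eq_iff: "equilibrium G (steady_state G u) \<longleftrightarrow> current_mismatch G u = 0" for u
    by (simp add: equilibrium_iff [OF wf]) (simp add: steady_state_def)
  have VL_ss: "VL (steady_state G u) = u" for u
    by (simp add: steady_state_def)
  have "\<exists>v. current_mismatch G v = 0 \<and> (\<forall>u<v. current_mismatch G u < 0)
    \<and> (\<forall>u>v. current_mismatch G u > 0)"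
  proof (rule current_mismatch_sign [OF wf])
    fix u assume u: "current_mismatch G u = 0"
    with eq_iff have e: "equilibrium G (steady_state G u)" by simp
    from assms(2) e show "Vmin G \<le> u" by (metis VL_ss)
    from assms(5) [rule_format, OF e] show "PL G / u\<^sup>2 \<le> net_conductance G"
      by (simp add: VL_ss net_conductance_def series_conductance_eq [OF wf] sum_subtractf)
  qed
  then obtain v where v: "current_mismatch G v = 0"
    and neg: "\<And>u. u < v \<Longrightarrow> current_mismatch G u < 0"
    and pos': "\<And>u. u > v \<Longrightarrow> current_mismatch G u > 0"
    by blast
  define e where "e = steady_state G v"
  have e: "equilibrium G e" using eq_iff v by (simp add: e_def)
  have unique: "x = e" if "equilibrium G x" for x
    using that neg pos' unfolding equilibrium_iff [OF wf] e_def by (metis less_irrefl linorder_neqE)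
  have W: "continuous_on UNIV (energy G)" and Wb: "\<And>c. bounded {x. energy G x \<le> c}"
    using continuous_on_energy [OF wf] bounded_energy_sublevel [OF wf] by auto
  have Wmin: "energy G e < energy G x" if "x \<noteq> e" for x
    using that unfolding e_def
    by (intro energy_strict_min [OF wf] reduced_potential_strict_min [OF wf] neg pos')
  obtain s where s: "s < 1" "\<And>y. 2 * coupling G y \<le> s * kinetic G y"
    using coupling_le_kinetic [OF wf assms(4)] by blast
  \<comment> \<open>The share of the dissipation that the coupling cannot consume.\<close>
  define D where "D x = (1 - s) * kinetic G (vfield G x)" for x
  have kin0: "kinetic G y \<ge> 0" for y
    unfolding kinetic_def using pos
    by (intro add_nonneg_nonneg sum_nonneg mult_nonneg_nonneg) (auto intro: less_imp_le)
  have D0: "D x \<ge> 0" for x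
    using s(1) kin0 by (simp add: D_def)
  have Dpos: "D x > 0" if "consistent G x" "x \<noteq> e" for x
  proof -
    have "kinetic G (vfield G x) \<noteq> 0"
      using consistent_vfield_zero [OF wf that(1)] unique that(2) by blast
    then show ?thesis using s(1) kin0 [of "vfield G x"] by (simp add: D_def)
  qed
  have "continuous_on UNIV (vfield G)"
    using lipschitz_vfield [OF wf] lipschitz_on_continuous_on by (auto simp: lipschitz_def)
  then have Dc: "continuous_on UNIV D"
    unfolding D_def [abs_def] kinetic_def by (intro continuous_intros)
  have closed: "closed {x. consistent G x}"
    unfolding consistent_def using less_imp_neq [OF pos(1), symmetric]
    by (intro closed_Collect_all closed_Collect_eq continuous_intros) auto
  have traj: "consistent G (x t)"
    "((\<lambda>t. energy G (x t)) has_real_derivative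
        - kinetic G (vfield G (x t)) + 2 * coupling G (vfield G (x t))) (at t within {0..})"
    "- kinetic G (vfield G (x t)) + 2 * coupling G (vfield G (x t)) \<le> - D (x t)"
    if tr: "trajectory G S x" and t: "0 \<le> t" for S x t
  proof -
    have S: "S = {0..}" by (rule trajectory_domain [OF wf tr])
    then have "forward_interval {0..}" "solution_on G {0..} x"
      using tr by (auto simp: trajectory_def)
    note vf = solution_on_imp_vfield [OF wf this, of t]
    show "consistent G (x t)" using vf(1) t by simp
    then have "dynamics G (x t) (vfield G (x t))"
      using dynamics_vfield_iff [OF wf] by blast
    then show "((\<lambda>t. energy G (x t)) has_real_derivative
        - kinetic G (vfield G (x t)) + 2 * coupling G (vfield G (x t))) (at t within {0..})"
      using vf(2) t by (intro has_real_derivative_energy [OF wf]) auto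
    show "- kinetic G (vfield G (x t)) + 2 * coupling G (vfield G (x t)) \<le> - D (x t)"
      using s(2) [of "vfield G (x t)"] by (simp add: D_def algebra_simps)
  qed
  have stable: "stable_equilibrium G e"
    unfolding stable_equilibrium_def
  proof (intro conjI e allI impI)
    fix \<epsilon> :: real assume "\<epsilon> > 0"
    then obtain \<alpha> where \<alpha>: "\<alpha> > 0" "\<And>x. energy G x < energy G e + \<alpha> \<Longrightarrow> dist x e < \<epsilon>"
      using sublevel_subset_ball [OF W Wb Wmin] by blast
    \<comment> \<open>Continuity bounds the initial energy; since energy never increases, the
      trajectory cannot leave the sublevel set inside the ball.\<close>
    then obtain \<delta> where \<delta>: "\<delta> > 0" "\<And>x. dist x e < \<delta> \<Longrightarrow> dist (energy G x) (energy G e) < \<alpha>"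
      using W unfolding continuous_on_iff by (metis UNIV_I)
    have "dist (x t) e < \<epsilon>" if tr: "trajectory G S x" and x0: "dist (x 0) e < \<delta>" and "t \<in> S" for S x t
    proof -
      have "0 \<le> t" using \<open>t \<in> S\<close> trajectory_domain [OF wf tr] by simp
      have "energy G (x t) - energy G (x 0) \<le> 0 * (t - 0)"
        using \<open>0 \<le> t\<close> by (intro nonincreasing_on_interval [OF _ _ _ _ traj(2) [OF tr]]
            order_trans [OF traj(3) [OF tr]]) (auto simp: is_interval_ci D0)
      moreover have "energy G (x 0) < energy G e + \<alpha>"
        using \<delta>(2) [OF x0] by (simp add: dist_real_def)
      ultimately show ?thesis by (intro \<alpha>(2)) simp
    qed
    with \<delta>(1) show "\<exists>\<delta>>0. \<forall>S x. trajectory G S x \<and> dist (x 0) e < \<delta> \<longrightarrow> (\<forall>t\<in>S. dist (x t) e < \<epsilon>)"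
      by blast
  qed
  have "(x \<longlongrightarrow> e) at_top" if "trajectory G S x" for S x
    using traj [OF that] Dpos
    by (intro lyapunov_convergence [OF W Wb Wmin Dc D0 closed]) auto
  with stable show ?thesis
    unfolding globally_asymptotically_stable_def using trajectory_domain [OF wf] by blast
qed

end
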